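(* Let $G_1,G_2$ be compact Lie groups acting smoothly on manifolds $X_1,X_2$, and let $(\varphi,f)\colon G_1\ltimes X_1\to G_2\ltimes X_2$ be an equivariant map of translation groupoids. Then we get an induced functor between the 2-categories $$\Pi(\varphi,f)\colon \Pi_{G_1}(X_1)\to\Pi_{G_2}(X_2).$$
   Context: **Translation groupoids and equivariant maps.** For a Lie group $G$ acting smoothly on the left on a manifold $X$, the translation groupoid $G\ltimes X$ has object space $X$ and arrow space $G\times X$, where $(g,x)$ is an arrow from $x$ to $gx$, and composition is $(g',gx)\circ(g,x)=(g'g,x)$. An equivariant map $G_1\ltimes X_1\to G_2\ltimes X_2$ is a pair $(\varphi,f)$ with $\varphi\colon G_1\to G_2$ a homomorphism of Lie groups and $f\colon X_1\to X_2$ a smooth map with $f(gx)=\varphi(g)f(x)$ for all $g\in G_1$, $x\in X_1$. **The 2-category $\Pi_G(X)$.** Let $G$ be a compact Lie group acting on $X$, and write $X^H=\{x\in X: hx=x\ \forall h\in H\}$. The orbit category $\mathcal O_G$ has objects $G/H$ for closed subgroups $H\le G$; an arrow $G/H\to G/K$ is a $G$-map, equivalently a coset $\alpha K\in (G/K)^H$ (i.e. $H\le \alpha K\alpha^{-1}$), written $\alpha$, sending $gH\mapsto g\alpha K$. For $y\in X^K$, the point $\alpha y\in X^H$ is well defined. Write $*$ for concatenation of paths. The 2-category $\Pi_G(X)$ is: - Objects: pairs $(G/H,x)$ with $H\le G$ closed and $x\in X^H$. - Arrows $(G/H,x)\to(G/K,y)$: pairs $(\alpha,[\gamma])$ with $\alpha\colon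 G/H\to G/K$ in $\mathcal O_G$ and $[\gamma]$ a homotopy class rel endpoints of paths in $X^H$ from $x$ to $\alpha y$. The composite of $(\alpha,[\gamma])\colon(G/H,x)\to(G/K,y)$ followed by $(\beta,[\zeta])\colon (G/K,y)\to(G/L,z)$ is $(\alpha\beta,[\gamma*\alpha\zeta])$. - 2-cells $(\alpha,[\gamma])\Rightarrow(\alpha',[\gamma'])$: homotopy classes rel endpoints $[\sigma]$ of paths $\sigma$ in $(G/K)^H$ from $\alpha$ to $\alpha'$ such that $\gamma*\sigma y$ is homotopic rel endpoints to $\gamma'$ in $X^H$. Vertical composition is concatenation. The horizontal composite of $[\sigma]\colon(\alpha,[\gamma])\Rightarrow(\alpha',[\gamma'])$ and $[\omega]\colon(\beta,[\zeta])\Rightarrow(\beta',[\zeta'])$ is $[\sigma\beta*\alpha'\omega]=[\alpha\omega*\sigma\beta']$. *)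

theory Defs
  imports "HOL-Analysis.Analysis" "HOL-Algebra.Group_Action" "HOL-Algebra.Left_Coset"
begin

section \<open>Smooth manifolds and smooth maps\<close>

text \<open>The model space of an \<open>n\<close>-dimensional manifold is \<^term>\<open>Euclidean_space n\<close>, so that
  dimension zero (finite groups, discrete spaces) is included.\<close>

fun Ck_on :: "nat \<Rightarrow> nat \<Rightarrow> (nat \<Rightarrow> real) set \<Rightarrow> ((nat \<Rightarrow> real) \<Rightarrow> real) \<Rightarrow> bool" where
  "Ck_on 0 n W u \<longleftrightarrow> continuous_map (subtopology (Euclidean_space n) W) euclideanreal u"
| "Ck_on (Suc k) n W u \<longleftrightarrow>
     continuous_map (subtopology (Euclidean_space n) W) euclideanreal u \<and>
     (\<forall>i<n. \<exists>u'. (\<forall>x\<in>W. ((\<lambda>t. u (x(i := t))) has_real_derivative u' x) (at (x i))) \<and>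
                 Ck_on k n W u')"

definition smooth_on ::
  "nat \<Rightarrow> nat \<Rightarrow> (nat \<Rightarrow> real) set \<Rightarrow> ((nat \<Rightarrow> real) \<Rightarrow> (nat \<Rightarrow> real)) \<Rightarrow> bool" where
  "smooth_on m n W F \<longleftrightarrow> (\<forall>i<n. \<forall>k. Ck_on k m W (\<lambda>x. F x i))"

text \<open>A chart is a pair of its domain and its coordinate map.  The atlas need not be maximal.\<close>

record 'a manifold =
  mtop :: "'a topology"
  mdim :: nat
  charts :: "('a set \<times> ('a \<Rightarrow> nat \<Rightarrow> real)) set"

definition smooth_manifold :: "'a manifold \<Rightarrow> bool" where
  "smooth_manifold M \<longleftrightarrow>
     Hausdorff_space (mtop M) \<and> second_countable (mtop M) \<and>
     (\<Union>(U, p)\<in>charts M. U) = topspace (mtop M) \<and>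
     (\<forall>(U, p)\<in>charts M.
        openin (mtop M) U \<and> openin (Euclidean_space (mdim M)) (p ` U) \<and>
        homeomorphic_map (subtopology (mtop M) U)
          (subtopology (Euclidean_space (mdim M)) (p ` U)) p) \<and>
     (\<forall>(U, p)\<in>charts M. \<forall>(V, q)\<in>charts M.
        smooth_on (mdim M) (mdim M) (p ` (U \<inter> V)) (\<lambda>v. q (inv_into U p v)))"

definition smooth_map :: "'a manifold \<Rightarrow> 'b manifold \<Rightarrow> ('a \<Rightarrow> 'b) \<Rightarrow> bool" where
  "smooth_map M N F \<longleftrightarrow>
     continuous_map (mtop M) (mtop N) F \<and>
     (\<forall>(U, p)\<in>charts M. \<forall>(V, q)\<in>charts N.
        smooth_on (mdim M) (mdim N) (p ` {x \<in> U. F x \<in> V}) (\<lambda>v. q (F (inv_into U p v))))"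

definition prod_manifold :: "'a manifold \<Rightarrow> 'b manifold \<Rightarrow> ('a \<times> 'b) manifold" where
  "prod_manifold M N =
     \<lparr> mtop = prod_topology (mtop M) (mtop N),
       mdim = mdim M + mdim N,
       charts = {(U \<times> V, \<lambda>(x, y) i. if i < mdim M then p x i else q y (i - mdim M)) | U p V q.
                   (U, p) \<in> charts M \<and> (V, q) \<in> charts N} \<rparr>"


section \<open>Lie groups, smooth actions, equivariant maps\<close>

record 'g lie_group = "'g monoid" +
  mfd :: "'g manifold"

abbreviation gtop :: "('g, 'z) lie_group_scheme \<Rightarrow> 'g topology" where
  "gtop G \<equiv> mtop (mfd G)"

locale lie_group = group G for G :: "('g, 'z) lie_group_scheme" (structure) +
  assumes mfd: "smooth_manifold (mfd G)"
    and topspace_gtop: "topspace (gtop G) = carrier G"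
    and smooth_mult: "smooth_map (prod_manifold (mfd G) (mfd G)) (mfd G) (\<lambda>(g, h). g \<otimes> h)"
    and smooth_inv: "smooth_map (mfd G) (mfd G) (\<lambda>g. inv g)"

locale compact_lie_group = lie_group +
  assumes compact: "compact_space (gtop G)"

locale smooth_action = lie_group G + group_action G "topspace (mtop X)" act
  for G :: "('g, 'z) lie_group_scheme" (structure) and X :: "'x manifold"
    and act :: "'g \<Rightarrow> 'x \<Rightarrow> 'x" +
  assumes space_mfd: "smooth_manifold X"
    and smooth_act: "smooth_map (prod_manifold (mfd G) X) X (\<lambda>(g, x). act g x)"

definition equivariant_map ::
  "('g1, 'z1) lie_group_scheme \<Rightarrow> 'x1 manifold \<Rightarrow> ('g1 \<Rightarrow> 'x1 \<Rightarrow> 'x1) \<Rightarrow>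
   ('g2, 'z2) lie_group_scheme \<Rightarrow> 'x2 manifold \<Rightarrow> ('g2 \<Rightarrow> 'x2 \<Rightarrow> 'x2) \<Rightarrow>
   ('g1 \<Rightarrow> 'g2) \<Rightarrow> ('x1 \<Rightarrow> 'x2) \<Rightarrow> bool" where
  "equivariant_map G1 X1 act1 G2 X2 act2 \<phi> f \<longleftrightarrow>
     \<phi> \<in> hom G1 G2 \<and> smooth_map (mfd G1) (mfd G2) \<phi> \<and>
     smooth_map X1 X2 f \<and>
     (\<forall>g\<in>carrier G1. \<forall>x\<in>topspace (mtop X1). f (act1 g x) = act2 (\<phi> g) (f x))"


section \<open>Strict 2-categories and strict 2-functors\<close>

text \<open>Arrows and 2-cells are indexed by their boundary, so hom-sets need not be disjoint and the
  operations take the boundaries of their arguments as parameters.  Composition of arrows and of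
  2-cells is written in diagrammatic order.\<close>

record ('o, 'a, 'c) two_cat =
  ob :: "'o set"
  arr :: "'o \<Rightarrow> 'o \<Rightarrow> 'a set"
  cell :: "'o \<Rightarrow> 'o \<Rightarrow> 'a \<Rightarrow> 'a \<Rightarrow> 'c set"
  id1 :: "'o \<Rightarrow> 'a"
  comp1 :: "'o \<Rightarrow> 'o \<Rightarrow> 'o \<Rightarrow> 'a \<Rightarrow> 'a \<Rightarrow> 'a"
  id2 :: "'o \<Rightarrow> 'o \<Rightarrow> 'a \<Rightarrow> 'c"
  vcomp :: "'o \<Rightarrow> 'o \<Rightarrow> 'a \<Rightarrow> 'a \<Rightarrow> 'a \<Rightarrow> 'c \<Rightarrow> 'c \<Rightarrow> 'c"
  hcomp :: "'o \<Rightarrow> 'o \<Rightarrow> 'o \<Rightarrow> 'a \<Rightarrow> 'a \<Rightarrow> 'a \<Rightarrow> 'a \<Rightarrow> 'c \<Rightarrow> 'c \<Rightarrow> 'c"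

locale two_category =
  fixes C :: "('o, 'a, 'c) two_cat"
  assumes id1_arr: "A \<in> ob C \<Longrightarrow> id1 C A \<in> arr C A A"
    and comp1_arr:
      "\<lbrakk>A \<in> ob C; B \<in> ob C; D \<in> ob C; f \<in> arr C A B; g \<in> arr C B D\<rbrakk>
       \<Longrightarrow> comp1 C A B D f g \<in> arr C A D"
    and comp1_id_left:
      "\<lbrakk>A \<in> ob C; B \<in> ob C; f \<in> arr C A B\<rbrakk> \<Longrightarrow> comp1 C A A B (id1 C A) f = f"
    and comp1_id_right:
      "\<lbrakk>A \<in> ob C; B \<in> ob C; f \<in> arr C A B\<rbrakk> \<Longrightarrow> comp1 C A B B f (id1 C B) = f"
    and comp1_assoc:
      "\<lbrakk>A \<in> ob C; B \<in> ob C; D \<in> ob C; E \<in> ob C;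
        f \<in> arr C A B; g \<in> arr C B D; h \<in> arr C D E\<rbrakk>
       \<Longrightarrow> comp1 C A D E (comp1 C A B D f g) h = comp1 C A B E f (comp1 C B D E g h)"
    and id2_cell:
      "\<lbrakk>A \<in> ob C; B \<in> ob C; f \<in> arr C A B\<rbrakk> \<Longrightarrow> id2 C A B f \<in> cell C A B f f"
    and vcomp_cell:
      "\<lbrakk>A \<in> ob C; B \<in> ob C; f \<in> arr C A B; f' \<in> arr C A B; f'' \<in> arr C A B;
        s \<in> cell C A B f f'; t \<in> cell C A B f' f''\<rbrakk>
       \<Longrightarrow> vcomp C A B f f' f'' s t \<in> cell C A B f f''"
    and vcomp_id_left:
      "\<lbrakk>A \<in> ob C; B \<in> ob C; f \<in> arr C A B; f' \<in> arr C A B; s \<in> cell C A B f f'\<rbrakk>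
       \<Longrightarrow> vcomp C A B f f f' (id2 C A B f) s = s"
    and vcomp_id_right:
      "\<lbrakk>A \<in> ob C; B \<in> ob C; f \<in> arr C A B; f' \<in> arr C A B; s \<in> cell C A B f f'\<rbrakk>
       \<Longrightarrow> vcomp C A B f f' f' s (id2 C A B f') = s"
    and vcomp_assoc:
      "\<lbrakk>A \<in> ob C; B \<in> ob C; f \<in> arr C A B; f' \<in> arr C A B; f'' \<in> arr C A B; f''' \<in> arr C A B;
        s \<in> cell C A B f f'; t \<in> cell C A B f' f''; u \<in> cell C A B f'' f'''\<rbrakk>
       \<Longrightarrow> vcomp C A B f f'' f''' (vcomp C A B f f' f'' s t) u =
           vcomp C A B f f' f''' s (vcomp C A B f' f'' f''' t u)"
    and hcomp_cell:
      "\<lbrakk>A \<in> ob C; B \<in> ob C; D \<in> ob C; f \<in> arr C A B; f' \<in> arr C A B; g \<in> arr C B D;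
        g' \<in> arr C B D; s \<in> cell C A B f f'; t \<in> cell C B D g g'\<rbrakk>
       \<Longrightarrow> hcomp C A B D f f' g g' s t \<in> cell C A D (comp1 C A B D f g) (comp1 C A B D f' g')"
    and hcomp_id2:
      "\<lbrakk>A \<in> ob C; B \<in> ob C; D \<in> ob C; f \<in> arr C A B; g \<in> arr C B D\<rbrakk>
       \<Longrightarrow> hcomp C A B D f f g g (id2 C A B f) (id2 C B D g) = id2 C A D (comp1 C A B D f g)"
    and interchange:
      "\<lbrakk>A \<in> ob C; B \<in> ob C; D \<in> ob C;
        f \<in> arr C A B; f' \<in> arr C A B; f'' \<in> arr C A B;
        g \<in> arr C B D; g' \<in> arr C B D; g'' \<in> arr C B D;
        s \<in> cell C A B f f'; s' \<in> cell C A B f' f'';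
        t \<in> cell C B D g g'; t' \<in> cell C B D g' g''\<rbrakk>
       \<Longrightarrow> hcomp C A B D f f'' g g'' (vcomp C A B f f' f'' s s') (vcomp C B D g g' g'' t t') =
           vcomp C A D (comp1 C A B D f g) (comp1 C A B D f' g') (comp1 C A B D f'' g'')
             (hcomp C A B D f f' g g' s t) (hcomp C A B D f' f'' g' g'' s' t')"
    and hcomp_id_left:
      "\<lbrakk>A \<in> ob C; B \<in> ob C; f \<in> arr C A B; f' \<in> arr C A B; s \<in> cell C A B f f'\<rbrakk>
       \<Longrightarrow> hcomp C A A B (id1 C A) (id1 C A) f f' (id2 C A A (id1 C A)) s = s"
    and hcomp_id_right:
      "\<lbrakk>A \<in> ob C; B \<in> ob C; f \<in> arr C A B; f' \<in> arr C A B; s \<in> cell C A B f f'\<rbrakk>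
       \<Longrightarrow> hcomp C A B B f f' (id1 C B) (id1 C B) s (id2 C B B (id1 C B)) = s"
    and hcomp_assoc:
      "\<lbrakk>A \<in> ob C; B \<in> ob C; D \<in> ob C; E \<in> ob C;
        f \<in> arr C A B; f' \<in> arr C A B; g \<in> arr C B D; g' \<in> arr C B D;
        h \<in> arr C D E; h' \<in> arr C D E;
        s \<in> cell C A B f f'; t \<in> cell C B D g g'; u \<in> cell C D E h h'\<rbrakk>
       \<Longrightarrow> hcomp C A D E (comp1 C A B D f g) (comp1 C A B D f' g') h h'
             (hcomp C A B D f f' g g' s t) u =
           hcomp C A B E f f' (comp1 C B D E g h) (comp1 C B D E g' h')
             s (hcomp C B D E g g' h h' t u)"

record ('o1, 'a1, 'c1, 'o2, 'a2, 'c2) two_map =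
  map0 :: "'o1 \<Rightarrow> 'o2"
  map1 :: "'o1 \<Rightarrow> 'o1 \<Rightarrow> 'a1 \<Rightarrow> 'a2"
  map2 :: "'o1 \<Rightarrow> 'o1 \<Rightarrow> 'a1 \<Rightarrow> 'a1 \<Rightarrow> 'c1 \<Rightarrow> 'c2"

locale two_functor = src: two_category C + trg: two_category D
  for C :: "('o1, 'a1, 'c1) two_cat" and D :: "('o2, 'a2, 'c2) two_cat" +
  fixes F :: "('o1, 'a1, 'c1, 'o2, 'a2, 'c2) two_map"
  assumes map0_ob: "A \<in> ob C \<Longrightarrow> map0 F A \<in> ob D"
    and map1_arr:
      "\<lbrakk>A \<in> ob C; B \<in> ob C; f \<in> arr C A B\<rbrakk> \<Longrightarrow> map1 F A B f \<in> arr D (map0 F A) (map0 F B)"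
    and map2_cell:
      "\<lbrakk>A \<in> ob C; B \<in> ob C; f \<in> arr C A B; f' \<in> arr C A B; s \<in> cell C A B f f'\<rbrakk>
       \<Longrightarrow> map2 F A B f f' s
           \<in> cell D (map0 F A) (map0 F B) (map1 F A B f) (map1 F A B f')"
    and map1_id1: "A \<in> ob C \<Longrightarrow> map1 F A A (id1 C A) = id1 D (map0 F A)"
    and map1_comp1:
      "\<lbrakk>A \<in> ob C; B \<in> ob C; E \<in> ob C; f \<in> arr C A B; g \<in> arr C B E\<rbrakk>
       \<Longrightarrow> map1 F A E (comp1 C A B E f g) =
           comp1 D (map0 F A) (map0 F B) (map0 F E) (map1 F A B f) (map1 F B E g)"
    and map2_id2:
      "\<lbrakk>A \<in> ob C; B \<in> ob C; f \<in> arr C A B\<rbrakk>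
       \<Longrightarrow> map2 F A B f f (id2 C A B f) = id2 D (map0 F A) (map0 F B) (map1 F A B f)"
    and map2_vcomp:
      "\<lbrakk>A \<in> ob C; B \<in> ob C; f \<in> arr C A B; f' \<in> arr C A B; f'' \<in> arr C A B;
        s \<in> cell C A B f f'; t \<in> cell C A B f' f''\<rbrakk>
       \<Longrightarrow> map2 F A B f f'' (vcomp C A B f f' f'' s t) =
           vcomp D (map0 F A) (map0 F B) (map1 F A B f) (map1 F A B f') (map1 F A B f'')
             (map2 F A B f f' s) (map2 F A B f' f'' t)"
    and map2_hcomp:
      "\<lbrakk>A \<in> ob C; B \<in> ob C; E \<in> ob C; f \<in> arr C A B; f' \<in> arr C A B; g \<in> arr C B E;
        g' \<in> arr C B E; s \<in> cell C A B f f'; t \<in> cell C B E g g'\<rbrakk>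
       \<Longrightarrow> map2 F A E (comp1 C A B E f g) (comp1 C A B E f' g') (hcomp C A B E f f' g g' s t) =
           hcomp D (map0 F A) (map0 F B) (map0 F E)
             (map1 F A B f) (map1 F A B f') (map1 F B E g) (map1 F B E g')
             (map2 F A B f f' s) (map2 F B E g g' t)"


section \<open>Paths in a topological space\<close>

text \<open>The library notions \<^const>\<open>homotopic_paths\<close> and \<^const>\<open>joinpaths\<close> are tied to a type class of
  topological spaces; these are the same definitions for an arbitrary topology.  Paths are
  functions on the reals of which only the values on the unit interval matter.\<close>

definition path_homotopic :: "'a topology \<Rightarrow> (real \<Rightarrow> 'a) \<Rightarrow> (real \<Rightarrow> 'a) \<Rightarrow> bool" where
  "path_homotopic T p q \<longleftrightarrow>
     homotopic_with (\<lambda>r. r 0 = p 0 \<and> r 1 = p 1) (top_of_set {0..1}) T p q"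

definition path_class :: "'a topology \<Rightarrow> (real \<Rightarrow> 'a) \<Rightarrow> (real \<Rightarrow> 'a) set" where
  "path_class T p = {q. path_homotopic T p q}"

definition join :: "(real \<Rightarrow> 'a) \<Rightarrow> (real \<Rightarrow> 'a) \<Rightarrow> real \<Rightarrow> 'a" where
  "join p q = (\<lambda>t. if t \<le> 1/2 then p (2 * t) else q (2 * t - 1))"


section \<open>Fixed points and orbits\<close>

definition fixed_space ::
  "'x manifold \<Rightarrow> ('g \<Rightarrow> 'x \<Rightarrow> 'x) \<Rightarrow> 'g set \<Rightarrow> 'x topology" where
  "fixed_space X act H =
     subtopology (mtop X) {x \<in> topspace (mtop X). \<forall>h\<in>H. act h x = x}"

definition orbit_space :: "('g, 'z) lie_group_scheme \<Rightarrow> 'g set \<Rightarrow> 'g set topology" where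
  "orbit_space G K =
     topology (\<lambda>U. U \<subseteq> lcosets\<^bsub>G\<^esub> K \<and> openin (gtop G) {g \<in> carrier G. g <#\<^bsub>G\<^esub> K \<in> U})"

lemma (in lie_group) openin_orbit_space:
  "openin (orbit_space G K) U \<longleftrightarrow>
     U \<subseteq> lcosets K \<and> openin (gtop G) {g \<in> carrier G. g <# K \<in> U}"
proof -
  let ?P = "\<lambda>U. U \<subseteq> lcosets K \<and> openin (gtop G) {g \<in> carrier G. g <# K \<in> U}"
  have "istopology ?P"
    unfolding istopology_def
  proof (intro conjI allI impI)
    fix S T assume S: "?P S" and T: "?P T"
    have "{g \<in> carrier G. g <# K \<in> S \<inter> T} =
        {g \<in> carrier G. g <# K \<in> S} \<inter> {g \<in> carrier G. g <# K \<in> T}" by auto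
    then show "openin (gtop G) {g \<in> carrier G. g <# K \<in> S \<inter> T}"
      using S T by auto
    show "S \<inter> T \<subseteq> lcosets K" using S by auto
  next
    fix \<K> assume K: "\<forall>S\<in>\<K>. ?P S"
    have "{g \<in> carrier G. g <# K \<in> \<Union>\<K>} = \<Union>((\<lambda>S. {g \<in> carrier G. g <# K \<in> S}) ` \<K>)" by auto
    then show "openin (gtop G) {g \<in> carrier G. g <# K \<in> \<Union>\<K>}"
      using K by auto
    show "\<Union>\<K> \<subseteq> lcosets K" using K by auto
  qed
  then show ?thesis
    by (simp add: orbit_space_def topology_inverse')
qed

text \<open>\<open>(G/K)\<^sup>H\<close>; its points are the arrows \<open>G/H \<rightarrow> G/K\<close> of the orbit category.\<close>

definition orbit_fixed_space ::
  "('g, 'z) lie_group_scheme \<Rightarrow> 'g set \<Rightarrow> 'g set \<Rightarrow> 'g set topology" where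
  "orbit_fixed_space G K H =
     subtopology (orbit_space G K) {\<alpha> \<in> lcosets\<^bsub>G\<^esub> K. \<forall>h\<in>H. h <#\<^bsub>G\<^esub> \<alpha> = \<alpha>}"

text \<open>For \<open>\<alpha> = aK\<close> and \<open>y \<in> X\<^sup>K\<close> this is the point \<open>\<alpha>y = ay\<close>, independent of \<open>a \<in> \<alpha>\<close>.\<close>

definition coset_act :: "('g \<Rightarrow> 'x \<Rightarrow> 'x) \<Rightarrow> 'g set \<Rightarrow> 'x \<Rightarrow> 'x" where
  "coset_act act \<alpha> y = the_elem ((\<lambda>a. act a y) ` \<alpha>)"


section \<open>The 2-category and the induced map\<close>

text \<open>The object \<open>(G/H, x)\<close> is encoded as \<open>(H, x)\<close>.  The composite of \<open>\<alpha> = aK\<close> and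
  \<open>\<beta> = bL\<close> in \<open>(G/L)\<^sup>K\<close> is the coset \<open>abL\<close>; since \<open>KbL = bL\<close>, it is the product
  \<^term>\<open>\<alpha> <#>\<^bsub>G\<^esub> \<beta>\<close> of the sets \<open>\<alpha>\<close> and \<open>\<beta>\<close>.  Operations on homotopy classes are given by the
  union over all representatives of the class of the result.\<close>

type_synonym ('g, 'x) Pi_ob = "'g set \<times> 'x"
type_synonym ('g, 'x) Pi_arr = "'g set \<times> (real \<Rightarrow> 'x) set"
type_synonym 'g Pi_cell = "(real \<Rightarrow> 'g set) set"

definition Pi_two_cat ::
  "('g, 'z) lie_group_scheme \<Rightarrow> 'x manifold \<Rightarrow> ('g \<Rightarrow> 'x \<Rightarrow> 'x) \<Rightarrow>
   (('g, 'x) Pi_ob, ('g, 'x) Pi_arr, 'g Pi_cell) two_cat" where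
  "Pi_two_cat G X act =
     \<lparr> ob = {(H, x). subgroup H G \<and> closedin (gtop G) H \<and> x \<in> topspace (fixed_space X act H)},
       arr = (\<lambda>(H, x) (K, y).
         {(\<alpha>, path_class (fixed_space X act H) \<gamma>) | \<alpha> \<gamma>.
            \<alpha> \<in> topspace (orbit_fixed_space G K H) \<and>
            pathin (fixed_space X act H) \<gamma> \<and> \<gamma> 0 = x \<and> \<gamma> 1 = coset_act act \<alpha> y}),
       cell = (\<lambda>(H, x) (K, y) (\<alpha>, c) (\<alpha>', c').
         {path_class (orbit_fixed_space G K H) \<sigma> | \<sigma>.
            pathin (orbit_fixed_space G K H) \<sigma> \<and> \<sigma> 0 = \<alpha> \<and> \<sigma> 1 = \<alpha>' \<and>
            (\<exists>\<gamma>\<in>c. \<exists>\<gamma>'\<in>c'.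
               path_homotopic (fixed_space X act H) (join \<gamma> (\<lambda>t. coset_act act (\<sigma> t) y)) \<gamma>')}),
       id1 = (\<lambda>(H, x). (H, path_class (fixed_space X act H) (\<lambda>_. x))),
       comp1 = (\<lambda>(H, x) (K, y) (L, z) (\<alpha>, c) (\<beta>, d).
         (\<alpha> <#>\<^bsub>G\<^esub> \<beta>,
          \<Union>\<gamma>\<in>c. \<Union>\<zeta>\<in>d.
            path_class (fixed_space X act H) (join \<gamma> (\<lambda>t. coset_act act \<alpha> (\<zeta> t))))),
       id2 = (\<lambda>(H, x) (K, y) (\<alpha>, c). path_class (orbit_fixed_space G K H) (\<lambda>_. \<alpha>)),
       vcomp = (\<lambda>(H, x) (K, y) _ _ _ s t.
         \<Union>\<sigma>\<in>s. \<Union>\<tau>\<in>t. path_class (orbit_fixed_space G K H) (join \<sigma> \<tau>)),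
       hcomp = (\<lambda>(H, x) (K, y) (L, z) (\<alpha>, c) (\<alpha>', c') (\<beta>, d) (\<beta>', d') s w.
         \<Union>\<sigma>\<in>s. \<Union>\<omega>\<in>w.
           path_class (orbit_fixed_space G L H)
             (join (\<lambda>t. \<sigma> t <#>\<^bsub>G\<^esub> \<beta>) (\<lambda>t. \<alpha>' <#>\<^bsub>G\<^esub> \<omega> t))) \<rparr>"

text \<open>The induced map is \<open>(G\<^sub>1/H, x) \<mapsto> (G\<^sub>2/\<phi>(H), f x)\<close>,
  \<open>(\<alpha>, [\<gamma>]) \<mapsto> (\<phi>(\<alpha>), [f \<circ> \<gamma>])\<close>, \<open>[\<sigma>] \<mapsto> [\<phi> \<circ> \<sigma>]\<close>, where \<open>\<phi>\<close> sends the coset \<open>aK\<close> to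
  \<open>\<phi>(a)\<phi>(K)\<close>, which is the image of the set \<open>aK\<close> under \<open>\<phi>\<close>.\<close>

definition Pi_map ::
  "('g2, 'z2) lie_group_scheme \<Rightarrow> 'x2 manifold \<Rightarrow> ('g2 \<Rightarrow> 'x2 \<Rightarrow> 'x2) \<Rightarrow>
   ('g1 \<Rightarrow> 'g2) \<Rightarrow> ('x1 \<Rightarrow> 'x2) \<Rightarrow>
   (('g1, 'x1) Pi_ob, ('g1, 'x1) Pi_arr, 'g1 Pi_cell,
    ('g2, 'x2) Pi_ob, ('g2, 'x2) Pi_arr, 'g2 Pi_cell) two_map" where
  "Pi_map G2 X2 act2 \<phi> f =
     \<lparr> map0 = (\<lambda>(H, x). (\<phi> ` H, f x)),
       map1 = (\<lambda>(H, x) (K, y) (\<alpha>, c).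
         (\<phi> ` \<alpha>, \<Union>\<gamma>\<in>c. path_class (fixed_space X2 act2 (\<phi> ` H)) (f \<circ> \<gamma>))),
       map2 = (\<lambda>(H, x) (K, y) _ _ s.
         \<Union>\<sigma>\<in>s. path_class (orbit_fixed_space G2 (\<phi> ` K) (\<phi> ` H)) (\<lambda>t. \<phi> ` \<sigma> t)) \<rparr>"

end

theory Submission
  imports Defs
begin

text \<open>The cosets \<open>(G/K)\<^sup>H\<close> multiply, \<open>(G/K)\<^sup>H \<times> (G/L)\<^sup>K \<rightarrow> (G/L)\<^sup>H\<close>, and act, \<open>(G/K)\<^sup>H \<times> X\<^sup>K \<rightarrow> X\<^sup>H\<close>.
  Both maps are jointly continuous because \<open>G \<rightarrow> G/K\<close> is open, so that its products with other open
  maps and its restrictions to saturated subsets are still quotient maps.  The axioms of the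
  2-category then hold up to reparametrization of paths, except for the interchange law and the
  boundary condition of horizontal composites, which come from the homotopy between the two ways
  around a square \<open>(s, t) \<mapsto> \<sigma>(s)\<omega>(t)\<close> or \<open>(s, t) \<mapsto> \<sigma>(s)\<zeta>(t)\<close>.  The induced map preserves everything
  because \<open>\<phi>\<close> and \<open>f\<close> intertwine the multiplications and the actions; compactness of \<open>G\<^sub>1\<close> is what
  makes \<open>\<phi>(H)\<close> closed.\<close>

section \<open>Homotopy classes of paths\<close>

text \<open>Arrows and 2-cells contain sets of functions on all of the reals, and each operation is
  a union over all representatives. Such a union is a single class because the operation respects
  homotopy and the classes are nonempty, so each operation is rewritten as the class of one explicit
  path. To this end \<open>is_arr\<close> and \<open>is_cell\<close> put the boundary conditions on
  chosen representatives. The laws that hold for paths only up to homotopy thereby become strict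
  equations of classes, each resting on one homotopy between explicit paths.

  Laws such as \<open>H <#> \<alpha> = \<alpha>\<close> or (\<alpha>\<beta>)z = \<alpha>(\<beta>z)
  are available only for points of the right fixed spaces, and a path is known to lie there only at
  times in the unit interval. Along a path they therefore enter as homotopies
  (\<open>path_homotopic_eq\<close>), not as equalities of functions. Reparametrizations and the
  exchange around a square both come from one straight-line homotopy in a convex parameter domain,
  pushed forward by a continuous map.\<close>

lemma path_homotopic_iff:
  "path_homotopic T p q \<longleftrightarrow>
     (\<exists>h. continuous_map (prod_topology (top_of_set {0..1::real}) (top_of_set {0..1::real})) T h \<and>
          (\<forall>t\<in>{0..1}. h (0, t) = p t) \<and> (\<forall>t\<in>{0..1}. h (1, t) = q t) \<and>
          (\<forall>s\<in>{0..1}. h (s, 0) = p 0 \<and> h (s, 1) = p 1))"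
  unfolding path_homotopic_def by (subst homotopic_with) auto

lemma path_homotopic_refl: "pathin T p \<Longrightarrow> path_homotopic T p p"
  by (simp add: path_homotopic_def pathin_def)

lemma path_homotopicD:
  assumes "path_homotopic T p q"
  shows "pathin T p" "pathin T q" "q 0 = p 0" "q 1 = p 1"
  using homotopic_with_imp_continuous_maps[OF assms[unfolded path_homotopic_def]]
    homotopic_with_imp_property[OF assms[unfolded path_homotopic_def]]
  by (simp_all add: pathin_def)

lemma path_homotopic_sym: "path_homotopic T p q \<Longrightarrow> path_homotopic T q p"
  using path_homotopicD(3,4)[of T p q] unfolding path_homotopic_def
  by (simp add: homotopic_with_sym)

lemma path_homotopic_trans [trans]:
  assumes "path_homotopic T p q" "path_homotopic T q r"
  shows "path_homotopic T p r"
  using assms path_homotopicD(3,4)[OF assms(1)] unfolding path_homotopic_def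
  by (auto intro: homotopic_with_trans)

lemma path_homotopic_image:
  assumes "path_homotopic T p q" "continuous_map T U k"
  shows "path_homotopic U (\<lambda>t. k (p t)) (\<lambda>t. k (q t))"
  using homotopic_with_compose_continuous_map_left[OF assms(1)[unfolded path_homotopic_def] assms(2),
      of "\<lambda>r. r 0 = k (p 0) \<and> r 1 = k (p 1)"]
  unfolding path_homotopic_def o_def by simp

lemma pathin_image: "pathin T p \<Longrightarrow> continuous_map T U k \<Longrightarrow> pathin U (\<lambda>t. k (p t))"
  using pathin_compose[of T p U k] by (simp add: o_def)

text \<open>Paths are functions on all of the reals, so an identity known only at times in the unit
  interval enters the calculus of classes as a homotopy.\<close>

lemma path_homotopic_eq:
  "pathin T p \<Longrightarrow> (\<And>t. t \<in> {0..1} \<Longrightarrow> p t = q t) \<Longrightarrow> path_homotopic T p q"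
  unfolding path_homotopic_def pathin_def by (rule homotopic_with_equal) auto

text \<open>The straight-line homotopy from \<open>p\<close> to \<open>q\<close> stays in the convex
  set \<open>S\<close> and is pushed forward by \<open>h\<close>. With \<open>S\<close> the unit
  interval this yields reparametrizations, with \<open>S\<close> the unit square the exchange of the
  two ways around it.\<close>

lemma path_homotopic_convex:
  fixes p q :: "real \<Rightarrow> 'b::real_normed_vector"
  assumes h: "continuous_map (top_of_set S) T h" and S: "convex S"
    and p: "continuous_on {0..1} p" "p \<in> {0..1} \<rightarrow> S"
    and q: "continuous_on {0..1} q" "q \<in> {0..1} \<rightarrow> S"
    and ends: "q 0 = p 0" "q 1 = p 1"
  shows "path_homotopic T (\<lambda>t. h (p t)) (\<lambda>t. h (q t))"
proof -
  define H where "H = (\<lambda>x. (1 - fst x) *\<^sub>R p (snd x) + fst x *\<^sub>R q (snd x))"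
  have "continuous_on ({0..1} \<times> {0..1}) H"
    unfolding H_def
    by (intro continuous_intros continuous_on_compose2[OF p(1)] continuous_on_compose2[OF q(1)]) auto
  moreover have "H \<in> ({0..1} \<times> {0..1}) \<rightarrow> S"
    using p(2) q(2) S unfolding H_def convex_alt by (auto simp: Pi_iff)
  ultimately have "continuous_map (top_of_set ({0..1} \<times> {0..1})) (top_of_set S) H"
    by auto
  then have "continuous_map (prod_topology (top_of_set {0..1}) (top_of_set {0..1})) T (h \<circ> H)"
    using h by (metis continuous_map_compose prod_topology_subtopology_eu)
  then show ?thesis
    unfolding path_homotopic_iff
    by (rule_tac x="h \<circ> H" in exI) (auto simp: H_def ends algebra_simps simp flip: scaleR_add_left)
qed

lemma path_homotopic_reparametrize:
  assumes "pathin T p" "continuous_on {0..1} u" "u \<in> {0..1} \<rightarrow> {0..1}" "u 0 = 0" "u 1 = 1"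
  shows "path_homotopic T (\<lambda>t. p (u t)) p"
  using path_homotopic_convex[of "{0..1}" T p u "\<lambda>t. t"] assms
  by (auto simp: pathin_def continuous_on_id)

section \<open>Concatenation of paths\<close>

lemma join_simps [simp]: "join p q 0 = p 0" "join p q 1 = q 1"
  by (simp_all add: join_def)

lemma image_join: "(\<lambda>t. k (join p q t)) = join (\<lambda>t. k (p t)) (\<lambda>t. k (q t))"
  by (auto simp: join_def)

lemma pathin_join:
  assumes "pathin T p" "pathin T q" "p 1 = q 0"
  shows "pathin T (join p q)"
  unfolding pathin_def join_def
proof (rule continuous_map_cases_le)
  let ?I = "top_of_set {0..1::real}"
  show "continuous_map ?I euclideanreal (\<lambda>t. t)" "continuous_map ?I euclideanreal (\<lambda>t. 1/2)"
    by auto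
  have "continuous_map (subtopology ?I {t \<in> topspace ?I. t \<le> 1/2}) ?I (\<lambda>t. 2 * t)"
    by (auto simp: subtopology_subtopology intro!: continuous_intros)
  then show "continuous_map (subtopology ?I {t \<in> topspace ?I. t \<le> 1/2}) T (\<lambda>t. p (2 * t))"
    using continuous_map_compose[of _ ?I "\<lambda>t. 2 * t" T p] assms by (simp add: pathin_def o_def)
  have "continuous_map (subtopology ?I {t \<in> topspace ?I. 1/2 \<le> t}) ?I (\<lambda>t. 2 * t - 1)"
    by (auto simp: subtopology_subtopology intro!: continuous_intros)
  then show "continuous_map (subtopology ?I {t \<in> topspace ?I. 1/2 \<le> t}) T (\<lambda>t. q (2 * t - 1))"
    using continuous_map_compose[of _ ?I "\<lambda>t. 2 * t - 1" T q] assms by (simp add: pathin_def o_def)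
qed (use assms in \<open>auto simp: mult.commute[of 2]\<close>)

lemma path_homotopic_join:
  assumes "path_homotopic T p p'" "path_homotopic T q q'" "p 1 = q 0"
  shows "path_homotopic T (join p q) (join p' q')"
proof -
  let ?I = "top_of_set {0..1::real}"
  let ?II = "prod_topology ?I ?I"
  obtain h where h: "continuous_map ?II T h" "\<forall>t\<in>{0..1}. h (0, t) = p t"
      "\<forall>t\<in>{0..1}. h (1, t) = p' t" "\<forall>s\<in>{0..1}. h (s, 0) = p 0 \<and> h (s, 1) = p 1"
    using assms(1) unfolding path_homotopic_iff by blast
  obtain k where k: "continuous_map ?II T k" "\<forall>t\<in>{0..1}. k (0, t) = q t"
      "\<forall>t\<in>{0..1}. k (1, t) = q' t" "\<forall>s\<in>{0..1}. k (s, 0) = q 0 \<and> k (s, 1) = q 1"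
    using assms(2) unfolding path_homotopic_iff by blast
  \<comment> \<open>The homotopy parameter is the first coordinate. On the seam
    \<open>snd x = 1/2\<close> both halves are constantly the common endpoint
    \<open>p 1 = q 0\<close>, so they fit together.\<close>
  define H where
    "H = (\<lambda>x. if snd x \<le> 1/2 then h (fst x, 2 * snd x) else k (fst x, 2 * snd x - 1))"
  have "continuous_map ?II T H"
    unfolding H_def
  proof (rule continuous_map_cases_le)
    show "continuous_map ?II euclideanreal snd" "continuous_map ?II euclideanreal (\<lambda>t. 1/2)"
      by (auto intro!: continuous_intros)
    have "continuous_map (subtopology ?II {t \<in> topspace ?II. snd t \<le> 1/2}) ?II (\<lambda>x. (fst x, 2 * snd x))"
      unfolding prod_topology_subtopology_eu by (auto simp: subtopology_subtopology intro!: continuous_intros)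
    then show "continuous_map (subtopology ?II {t \<in> topspace ?II. snd t \<le> 1/2}) T (\<lambda>x. h (fst x, 2 * snd x))"
      using continuous_map_compose[OF _ h(1)] by (force simp: o_def)
    have "continuous_map (subtopology ?II {t \<in> topspace ?II. 1/2 \<le> snd t}) ?II (\<lambda>x. (fst x, 2 * snd x - 1))"
      unfolding prod_topology_subtopology_eu by (auto simp: subtopology_subtopology intro!: continuous_intros)
    then show "continuous_map (subtopology ?II {t \<in> topspace ?II. 1/2 \<le> snd t}) T (\<lambda>x. k (fst x, 2 * snd x - 1))"
      using continuous_map_compose[OF _ k(1)] by (force simp: o_def)
  qed (use h k assms(3) in \<open>auto simp: mult.commute[of 2]\<close>)
  moreover have "\<forall>t\<in>{0..1}. H (0, t) = join p q t" "\<forall>t\<in>{0..1}. H (1, t) = join p' q' t"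
      "\<forall>s\<in>{0..1}. H (s, 0) = join p q 0 \<and> H (s, 1) = join p q 1"
    using h(2-) k(2-) by (auto simp: H_def join_def)
  ultimately show ?thesis
    unfolding path_homotopic_iff by blast
qed

text \<open>Waiting at the start is a reparametrization: max 0 (2t - 1) stays at 0 during the first
  half and then runs through the unit interval.\<close>

lemma path_homotopic_join_const_left:
  assumes "pathin T p" "x = p 0"
  shows "path_homotopic T (join (\<lambda>_. x) p) p"
proof -
  have "join (\<lambda>_. x) p = (\<lambda>t. p (max 0 (2 * t - 1)))"
    using assms(2)
    by (intro ext) (auto simp: join_def max_def not_le split: if_splits intro!: arg_cong[where f=p])
  moreover have "continuous_on {0..1} (\<lambda>t::real. max 0 (2 * t - 1))"
    by (intro continuous_intros)
  ultimately show ?thesis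
    using path_homotopic_reparametrize[OF assms(1), of "\<lambda>t. max 0 (2 * t - 1)"] by auto
qed

lemma path_homotopic_join_const_right:
  assumes "pathin T p" "x = p 1"
  shows "path_homotopic T (join p (\<lambda>_. x)) p"
proof -
  have "join p (\<lambda>_. x) = (\<lambda>t. p (min 1 (2 * t)))"
    using assms(2)
    by (intro ext) (auto simp: join_def min_def not_le split: if_splits intro!: arg_cong[where f=p])
  moreover have "continuous_on {0..1} (\<lambda>t::real. min 1 (2 * t))"
    by (intro continuous_intros)
  ultimately show ?thesis
    using path_homotopic_reparametrize[OF assms(1), of "\<lambda>t. min 1 (2 * t)"] by auto
qed

lemma path_homotopic_assoc:
  assumes "pathin T p" "pathin T q" "pathin T r" "p 1 = q 0" "q 1 = r 0"
  shows "path_homotopic T (join (join p q) r) (join p (join q r))"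
proof -
  \<comment> \<open>\<open>u\<close> carries the breakpoints 1/4 and 1/2 of the left bracketing to
    the breakpoints 1/2 and 3/4 of the right one. Its slopes 2, 1, 1/2 decrease, so it is the
    minimum of its three linear pieces, and continuity is immediate.\<close>
  define u :: "real \<Rightarrow> real" where "u t = min (2 * t) (min (t + 1/4) ((t + 1) / 2))" for t
  have "join (join p q) r = (\<lambda>t. join p (join q r) (u t))"
  proof
    fix t :: real
    consider "t \<le> 1/4" | "1/4 < t" "t \<le> 1/2" | "1/2 < t" by linarith
    then show "join (join p q) r t = join p (join q r) (u t)"
    proof cases
      case 1
      then have "u t = 2 * t" by (auto simp: u_def min_def)
      with 1 show ?thesis by (simp add: join_def)
    next
      case 2
      then have "u t = t + 1/4" by (auto simp: u_def min_def)
      with 2 show ?thesis by (simp add: join_def algebra_simps)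
    next
      case 3
      then have "u t = (t + 1) / 2" by (auto simp: u_def min_def)
      with 3 show ?thesis by (simp add: join_def add_divide_distrib algebra_simps)
    qed
  qed
  moreover have "continuous_on {0..1} u"
    unfolding u_def by (intro continuous_intros) auto
  moreover have "u \<in> {0..1} \<rightarrow> {0..1}" "u 0 = 0" "u 1 = 1"
    by (auto simp: u_def min_def)
  ultimately show ?thesis
    using path_homotopic_reparametrize[of T "join p (join q r)" u] assms
    by (simp add: pathin_join)
qed

text \<open>Rebracketing isolates the middle pair, which is exchanged by \<open>bc\<close>. This is
  the common shape of the interchange law and of the boundary condition for horizontal composites;
  in both the exchange is supplied by \<open>path_homotopic_square\<close>.\<close>

lemma path_homotopic_middle_four:
  assumes "pathin T a" "pathin T b" "pathin T c" "pathin T d" "pathin T b'" "pathin T c'"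
    and "a 1 = b 0" "b 1 = c 0" "c 1 = d 0" "c' 1 = b' 0"
    and bc: "path_homotopic T (join b c) (join c' b')"
  shows "path_homotopic T (join (join a b) (join c d)) (join (join a c') (join b' d))"
proof -
  have ends: "c' 0 = b 0" "b' 1 = c 1"
    using path_homotopicD(3,4)[OF bc] by simp_all
  note paths = assms(1-10) ends
  have "path_homotopic T (join (join a b) (join c d)) (join a (join b (join c d)))"
    using paths by (intro path_homotopic_assoc pathin_join) auto
  also have "path_homotopic T \<dots> (join a (join (join b c) d))"
    using paths by (intro path_homotopic_join path_homotopic_refl path_homotopic_sym[OF path_homotopic_assoc]) auto
  also have "path_homotopic T \<dots> (join a (join (join c' b') d))"
    using paths by (intro path_homotopic_join path_homotopic_refl bc) auto
  also have "path_homotopic T \<dots> (join a (join c' (join b' d)))"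
    using paths by (intro path_homotopic_join path_homotopic_refl path_homotopic_assoc) auto
  also have "path_homotopic T \<dots> (join (join a c') (join b' d))"
    using paths by (intro path_homotopic_sym[OF path_homotopic_assoc] pathin_join) auto
  finally show ?thesis .
qed

lemma path_homotopic_square:
  assumes h: "continuous_map (prod_topology S T) U (\<lambda>(x, y). h x y)"
    and p: "pathin S p" and q: "pathin T q"
  shows "path_homotopic U (join (\<lambda>t. h (p t) (q 0)) (\<lambda>t. h (p 1) (q t)))
           (join (\<lambda>t. h (p 0) (q t)) (\<lambda>t. h (p t) (q 1)))"
proof -
  let ?I = "{0..1::real}"
  \<comment> \<open>(m, M) runs along the bottom edge of the unit square and then up the right edge,
    (M, m) up the left edge and then along the top. Both lead from (0, 0) to (1, 1), so a
    straight-line homotopy in the square connects them.\<close>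
  define m M :: "real \<Rightarrow> real" where "m t = min 1 (2 * t)" and "M t = max 0 (2 * t - 1)" for t
  have "continuous_map (prod_topology (top_of_set ?I) (top_of_set ?I)) (prod_topology S T)
      (\<lambda>(s, t). (p s, q t))"
    using p q by (subst continuous_map_prod_top) (simp_all add: pathin_def)
  from continuous_map_compose[OF this h]
  have "continuous_map (top_of_set (?I \<times> ?I)) U (\<lambda>(s, t). h (p s) (q t))"
    by (simp add: o_def case_prod_unfold flip: prod_topology_subtopology_eu)
  moreover have "continuous_on {0..1} m" "continuous_on {0..1} M"
    unfolding m_def M_def by (intro continuous_intros)+
  then have "continuous_on {0..1} (\<lambda>t. (m t, M t))" "continuous_on {0..1} (\<lambda>t. (M t, m t))"
    by (intro continuous_intros; simp)+
  ultimately have "path_homotopic U (\<lambda>t. h (p (m t)) (q (M t))) (\<lambda>t. h (p (M t)) (q (m t)))"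
    using path_homotopic_convex[of "?I \<times> ?I" U "\<lambda>(s, t). h (p s) (q t)"
        "\<lambda>t. (m t, M t)" "\<lambda>t. (M t, m t)"]
    by (auto simp: m_def M_def convex_Times)
  moreover have "(\<lambda>t. h (p (m t)) (q (M t))) = join (\<lambda>t. h (p t) (q 0)) (\<lambda>t. h (p 1) (q t))"
    "(\<lambda>t. h (p (M t)) (q (m t))) = join (\<lambda>t. h (p 0) (q t)) (\<lambda>t. h (p t) (q 1))"
    by (rule ext, rule_tac x=t and y="1/2" in linorder_cases,
        simp_all add: join_def m_def M_def min_def max_def mult.commute[of 2])+
  ultimately show ?thesis by simp
qed

lemma pathin_in_topspace: "pathin T p \<Longrightarrow> t \<in> {0..1} \<Longrightarrow> p t \<in> topspace T"
  using path_image_subset_topspace by blast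

lemma continuous_map_prod_section:
  assumes "continuous_map (prod_topology S T) U (\<lambda>(x, y). h x y)"
  shows "y \<in> topspace T \<Longrightarrow> continuous_map S U (\<lambda>x. h x y)"
    and "x \<in> topspace S \<Longrightarrow> continuous_map T U (\<lambda>y. h x y)"
  using continuous_map_compose[OF continuous_map_pairedI[of S S "\<lambda>x. x" T "\<lambda>_. y"] assms]
    continuous_map_compose[OF continuous_map_pairedI[of T S "\<lambda>_. x" T "\<lambda>y. y"] assms]
  by (simp_all add: o_def)

section \<open>Operations on homotopy classes through representatives\<close>

lemma path_class_eqI: "path_homotopic T p q \<Longrightarrow> path_class T p = path_class T q"
  unfolding path_class_def by (auto intro: path_homotopic_trans path_homotopic_sym)

text \<open>All classes in the union coincide because \<open>k\<close> respects homotopy, and the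
  union is not over the empty set because a path is homotopic to itself. The class of a function
  that is not a path would be empty.\<close>

lemma UN_path_class:
  assumes "pathin T p" "\<And>p'. path_homotopic T p p' \<Longrightarrow> path_homotopic U (k p) (k p')"
  shows "(\<Union>p'\<in>path_class T p. path_class U (k p')) = path_class U (k p)"
proof -
  have "path_class U (k p') = path_class U (k p)" if "p' \<in> path_class T p" for p'
    using that assms(2) path_class_eqI unfolding path_class_def by blast
  moreover have "p \<in> path_class T p"
    using assms(1) by (simp add: path_class_def path_homotopic_refl)
  ultimately show ?thesis by blast
qed

lemma UN_path_class2:
  assumes "pathin S p" "pathin T q"
    and "\<And>p' q'. path_homotopic S p p' \<Longrightarrow> path_homotopic T q q' \<Longrightarrow> path_homotopic U (k p q) (k p' q')"
  shows "(\<Union>p'\<in>path_class S p. \<Union>q'\<in>path_class T q. path_class U (k p' q')) = path_class U (k p q)"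
proof -
  have "path_class U (k p' q') = path_class U (k p q)"
    if "p' \<in> path_class S p" "q' \<in> path_class T q" for p' q'
    using that assms(3) path_class_eqI unfolding path_class_def by blast
  moreover have "p \<in> path_class S p" "q \<in> path_class T q"
    using assms(1,2) by (simp_all add: path_class_def path_homotopic_refl)
  ultimately show ?thesis by blast
qed

no_notation (ASCII) subset_mset (infix \<open><#\<close> 50)

section \<open>Coset spaces and their action on fixed points\<close>

text \<open>A product of quotient maps need not be a quotient map; openness repairs this. An open
  rectangle around a lift of the given point is carried by \<open>p\<close> and \<open>q\<close> to
  an open rectangle around the point itself, still inside the preimage of \<open>V\<close>.\<close>

lemma continuous_map_prod_open_quotient:
  assumes p: "open_map A A' p" "topspace A' = p ` topspace A"
    and q: "open_map B B' q" "topspace B' = q ` topspace B"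
    and h: "continuous_map (prod_topology A B) Z (\<lambda>(x, y). h (p x) (q y))"
  shows "continuous_map (prod_topology A' B') Z (\<lambda>(x, y). h x y)"
  unfolding continuous_map_def
proof (intro conjI allI impI)
  show "(\<lambda>(x, y). h x y) \<in> topspace (prod_topology A' B') \<rightarrow> topspace Z"
    using continuous_map_funspace[OF h] p(2) q(2) by (auto simp: Pi_iff)
  fix V assume "openin Z V"
  define W where "W = {z \<in> topspace (prod_topology A B). (\<lambda>(x, y). h (p x) (q y)) z \<in> V}"
  have "openin (prod_topology A B) W"
    unfolding W_def using h \<open>openin Z V\<close> by (rule openin_continuous_map_preimage)
  moreover have W_iff: "(x, y) \<in> W \<longleftrightarrow> x \<in> topspace A \<and> y \<in> topspace B \<and> h (p x) (q y) \<in> V" for x y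
    by (simp add: W_def)
  ultimately have W: "\<exists>M N. openin A M \<and> openin B N \<and> x \<in> M \<and> y \<in> N \<and> M \<times> N \<subseteq> W"
    if "x \<in> topspace A" "y \<in> topspace B" "h (p x) (q y) \<in> V" for x y
    using that unfolding openin_prod_topology_alt by simp
  have "\<exists>M' N'. openin A' M' \<and> openin B' N' \<and> x' \<in> M' \<and> y' \<in> N' \<and>
        M' \<times> N' \<subseteq> {z \<in> topspace (prod_topology A' B'). (\<lambda>(x, y). h x y) z \<in> V}"
    if "x' \<in> topspace A'" "y' \<in> topspace B'" "h x' y' \<in> V" for x' y'
  proof -
    obtain x y where xy: "x \<in> topspace A" "y \<in> topspace B" "x' = p x" "y' = q y"
      using \<open>x' \<in> topspace A'\<close> \<open>y' \<in> topspace B'\<close> p(2) q(2) by auto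
    then obtain M N where MN: "openin A M" "openin B N" "x \<in> M" "y \<in> N" "M \<times> N \<subseteq> W"
      using W[of x y] \<open>h x' y' \<in> V\<close> by auto
    have "h (p a) (q b) \<in> V" if "a \<in> M" "b \<in> N" for a b
      using that MN(5) W_iff by blast
    moreover have "openin A' (p ` M)" "openin B' (q ` N)"
      using p(1) q(1) MN unfolding open_map_def by auto
    moreover from this have "p ` M \<subseteq> topspace A'" "q ` N \<subseteq> topspace B'"
      by (simp_all add: openin_subset)
    ultimately show ?thesis
      using xy MN by (intro exI[of _ "p ` M"] exI[of _ "q ` N"]) auto
  qed
  then show "openin (prod_topology A' B') {z \<in> topspace (prod_topology A' B'). (\<lambda>(x, y). h x y) z \<in> V}"
    unfolding openin_prod_topology_alt by simp
qed

section \<open>Cosets and products of subsets in a group\<close>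

lemma (in group) l_coset_eq_iff:
  assumes "subgroup K G" "a \<in> carrier G" "b \<in> carrier G"
  shows "a <# K = b <# K \<longleftrightarrow> (\<exists>k\<in>K. b = a \<otimes> k)"
proof
  assume "a <# K = b <# K"
  then have "b \<in> a <# K" using lcos_self assms by auto
  then show "\<exists>k\<in>K. b = a \<otimes> k" by (auto simp: l_coset_def)
next
  assume "\<exists>k\<in>K. b = a \<otimes> k"
  then have "b \<in> a <# K" by (auto simp: l_coset_def)
  then show "a <# K = b <# K" using l_repr_independence assms by blast
qed

lemma (in group) subgroup_set_mult_absorb:
  assumes "subgroup K G" "\<And>k. k \<in> K \<Longrightarrow> k <# S = S"
  shows "K <#> S = S"
proof -
  have "K <#> S = (\<Union>k\<in>K. k <# S)" by (simp add: set_mult_def l_coset_def)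
  also have "\<dots> = S" using assms(2) subgroup.one_closed[OF assms(1)] by auto
  finally show ?thesis .
qed

lemma (in group) l_coset_set_mult_assoc:
  assumes "a \<in> carrier G" "S \<subseteq> carrier G" "T \<subseteq> carrier G"
  shows "a <# S <#> T = a <# (S <#> T)"
  using set_mult_assoc[of "{a}" S T] assms by (simp add: l_coset_eq_set_mult)

context lie_group
begin

section \<open>Topology of coset spaces and of their fixed points\<close>

lemma continuous_map_mult: "continuous_map (prod_topology (gtop G) (gtop G)) (gtop G) (\<lambda>(g, h). g \<otimes> h)"
  using smooth_mult by (simp add: smooth_map_def prod_manifold_def)

lemma topspace_orbit_space: "topspace (orbit_space G K) = lcosets K"
proof -
  have "{g \<in> carrier G. g <# K \<in> lcosets K} = topspace (gtop G)"
    by (auto simp: LCOSETS_def topspace_gtop)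
  then have "openin (orbit_space G K) (lcosets K)"
    by (metis openin_orbit_space openin_topspace subset_refl)
  then show ?thesis
    by (metis openin_orbit_space openin_subset openin_topspace subset_antisym)
qed

lemma topspace_orbit_fixed_space:
  "topspace (orbit_fixed_space G K H) = {\<alpha> \<in> lcosets K. \<forall>h\<in>H. h <# \<alpha> = \<alpha>}"
  by (auto simp: orbit_fixed_space_def topspace_orbit_space)

lemma orbit_fixed_spaceE:
  assumes "\<alpha> \<in> topspace (orbit_fixed_space G K H)"
  obtains a where "a \<in> carrier G" "\<alpha> = a <# K"
  using assms by (auto simp: topspace_orbit_fixed_space LCOSETS_def)

lemma orbit_fixed_space_subset:
  assumes "\<alpha> \<in> topspace (orbit_fixed_space G K H)" "subgroup K G"
  shows "\<alpha> \<subseteq> carrier G"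
  using assms by (metis orbit_fixed_spaceE l_coset_subset_G subgroup.subset)

lemma continuous_map_orbit_space: "continuous_map (gtop G) (orbit_space G K) (\<lambda>g. g <# K)"
  unfolding continuous_map_def openin_orbit_space
  by (auto simp: topspace_orbit_space LCOSETS_def topspace_gtop)

lemma open_map_orbit_space:
  assumes K: "subgroup K G"
  shows "open_map (gtop G) (orbit_space G K) (\<lambda>g. g <# K)"
  unfolding open_map_def openin_orbit_space
proof (intro allI impI conjI)
  fix U assume U: "openin (gtop G) U"
  then have UG: "U \<subseteq> carrier G" using openin_subset topspace_gtop by blast
  then show "(\<lambda>g. g <# K) ` U \<subseteq> lcosets K" by (auto simp: LCOSETS_def)
  have KG: "K \<subseteq> carrier G" using K by (rule subgroup.subset)
  \<comment> \<open>The saturation of \<open>U\<close> is the union of its right translates by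
    elements of \<open>K\<close>. Each translate is written as the preimage of \<open>U\<close>
    under right multiplication by some \<open>k\<close>, which is open by continuity.\<close>
  have "{g \<in> carrier G. g <# K \<in> (\<lambda>g. g <# K) ` U} = (\<Union>k\<in>K. {g \<in> topspace (gtop G). g \<otimes> k \<in> U})"
  proof -
    have "g <# K \<in> (\<lambda>g. g <# K) ` U \<longleftrightarrow> (\<exists>k\<in>K. g \<otimes> k \<in> U)" if "g \<in> carrier G" for g
      using that UG l_coset_eq_iff[OF K that] by (auto simp: image_iff subset_iff)
    then show ?thesis unfolding topspace_gtop by blast
  qed
  moreover have "openin (gtop G) {g \<in> topspace (gtop G). g \<otimes> k \<in> U}" if "k \<in> K" for k
  proof (rule openin_continuous_map_preimage[OF _ U])
    have "continuous_map (gtop G) (prod_topology (gtop G) (gtop G)) (\<lambda>g. (g, k))"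
      using that KG by (auto simp: continuous_map_pairedI topspace_gtop)
    from continuous_map_compose[OF this continuous_map_mult]
    show "continuous_map (gtop G) (gtop G) (\<lambda>g. g \<otimes> k)" by (simp add: o_def)
  qed
  ultimately show "openin (gtop G) {g \<in> carrier G. g <# K \<in> (\<lambda>g. g <# K) ` U}" by auto
qed

text \<open>The part of \<open>G\<close> lying over (G/K)^H; for subgroups it consists of the a with
  H contained in aKa^(-1). Being a full preimage, it keeps the coset map open, which restriction to
  an arbitrary subset would not.\<close>

definition lift_space where
  "lift_space K H = subtopology (gtop G) {a \<in> carrier G. a <# K \<in> topspace (orbit_fixed_space G K H)}"

lemma topspace_lift_space:
  "topspace (lift_space K H) = {a \<in> carrier G. a <# K \<in> topspace (orbit_fixed_space G K H)}"
  by (auto simp: lift_space_def topspace_gtop)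

lemma open_map_orbit_fixed_space:
  assumes "subgroup K G"
  shows "open_map (lift_space K H) (orbit_fixed_space G K H) (\<lambda>g. g <# K)"
  unfolding lift_space_def orbit_fixed_space_def
  by (rule open_map_restriction[OF open_map_orbit_space[OF assms]])
    (auto simp: topspace_gtop topspace_orbit_space)

lemma topspace_orbit_fixed_space_lift:
  "topspace (orbit_fixed_space G K H) = (\<lambda>g. g <# K) ` topspace (lift_space K H)"
  by (auto simp: topspace_lift_space elim: orbit_fixed_spaceE)

section \<open>Products of cosets fixed by subgroups\<close>

lemma unit_in_orbit_fixed_space:
  assumes "subgroup H G"
  shows "H \<in> topspace (orbit_fixed_space G H H)"
proof -
  have "H = \<one> <# H" using assms by (simp add: lcos_mult_one subgroup.subset)
  moreover have "h <# H = H" if "h \<in> H" for h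
    using that assms by (metis coset_join3 subgroup.mem_carrier)
  ultimately show ?thesis by (auto simp: topspace_orbit_fixed_space LCOSETS_def)
qed

lemma set_mult_unit_left:
  assumes "subgroup H G" "\<alpha> \<in> topspace (orbit_fixed_space G K H)"
  shows "H <#> \<alpha> = \<alpha>"
  using assms by (intro subgroup_set_mult_absorb) (auto simp: topspace_orbit_fixed_space)

text \<open>Reduces to KK = K, which is the left unit law for the coset \<open>K\<close> as a point
  of (G/K)^K.\<close>

lemma set_mult_unit_right:
  assumes "subgroup K G" "\<alpha> \<in> topspace (orbit_fixed_space G K H)"
  shows "\<alpha> <#> K = \<alpha>"
proof -
  obtain a where "a \<in> carrier G" "\<alpha> = a <# K" using assms(2) by (rule orbit_fixed_spaceE)
  then show ?thesis
    using set_mult_unit_left[OF assms(1) unit_in_orbit_fixed_space[OF assms(1)]] subgroup.subset[OF assms(1)]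
    by (simp add: l_coset_set_mult_assoc)
qed

text \<open>The factor \<open>K\<close> is absorbed because \<beta> is fixed by \<open>K\<close>.
  This is what makes the product of a coset of \<open>K\<close> with a point of (G/L)^K a single
  coset of \<open>L\<close>.\<close>

lemma l_coset_mult_fixed:
  assumes "subgroup K G" "subgroup L G" "a \<in> carrier G" "\<beta> \<in> topspace (orbit_fixed_space G L K)"
  shows "a <# K <#> \<beta> = a <# \<beta>"
  using l_coset_set_mult_assoc[OF assms(3) subgroup.subset[OF assms(1)] orbit_fixed_space_subset[OF assms(4,2)]]
    set_mult_unit_left[OF assms(1,4)] by simp

lemma l_coset_mult:
  assumes "subgroup K G" "subgroup L G" "a \<in> carrier G" "b \<in> carrier G"
    "b <# L \<in> topspace (orbit_fixed_space G L K)"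
  shows "a <# K <#> (b <# L) = a \<otimes> b <# L"
  using l_coset_mult_fixed[OF assms(1,2,3,5)] assms lcos_m_assoc subgroup.subset by metis

lemma set_mult_in_orbit_fixed_space:
  assumes "subgroup H G" "subgroup K G" "subgroup L G"
    and \<alpha>: "\<alpha> \<in> topspace (orbit_fixed_space G K H)" and \<beta>: "\<beta> \<in> topspace (orbit_fixed_space G L K)"
  shows "\<alpha> <#> \<beta> \<in> topspace (orbit_fixed_space G L H)"
proof -
  obtain a where a: "a \<in> carrier G" "\<alpha> = a <# K" using \<alpha> by (rule orbit_fixed_spaceE)
  obtain b where b: "b \<in> carrier G" "\<beta> = b <# L" using \<beta> by (rule orbit_fixed_spaceE)
  have "\<alpha> <#> \<beta> = a \<otimes> b <# L"
    using a b \<beta> assms(2,3) l_coset_mult by auto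
  then have "\<alpha> <#> \<beta> \<in> lcosets L"
    using a b by (auto simp: LCOSETS_def)
  moreover have "h <# (\<alpha> <#> \<beta>) = \<alpha> <#> \<beta>" if "h \<in> H" for h
    using l_coset_set_mult_assoc[of h \<alpha> \<beta>] that assms \<alpha>
      orbit_fixed_space_subset[OF \<alpha>] orbit_fixed_space_subset[OF \<beta>] subgroup.mem_carrier[of H G h]
    by (auto simp: topspace_orbit_fixed_space)
  ultimately show ?thesis by (auto simp: topspace_orbit_fixed_space)
qed

lemma set_mult_orbit_fixed_space_assoc:
  assumes "subgroup K G" "subgroup L G" "subgroup M G"
    and "\<alpha> \<in> topspace (orbit_fixed_space G K H)" "\<beta> \<in> topspace (orbit_fixed_space G L K)"
    and "\<eta> \<in> topspace (orbit_fixed_space G M L)"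
  shows "\<alpha> <#> \<beta> <#> \<eta> = \<alpha> <#> (\<beta> <#> \<eta>)"
  using set_mult_assoc assms orbit_fixed_space_subset by metis

text \<open>On lifts the product is multiplication in \<open>G\<close> followed by the coset map of
  \<open>L\<close>; openness of the coset maps on both factors lets continuity descend.\<close>

lemma continuous_map_set_mult:
  assumes H: "subgroup H G" and K: "subgroup K G" and L: "subgroup L G"
  shows "continuous_map (prod_topology (orbit_fixed_space G K H) (orbit_fixed_space G L K))
           (orbit_fixed_space G L H) (\<lambda>(\<alpha>, \<beta>). \<alpha> <#> \<beta>)"
proof (rule continuous_map_prod_open_quotient[OF open_map_orbit_fixed_space[OF K] topspace_orbit_fixed_space_lift
      open_map_orbit_fixed_space[OF L] topspace_orbit_fixed_space_lift])
  let ?P = "prod_topology (lift_space K H) (lift_space L K)"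
  have "continuous_map ?P (gtop G) (\<lambda>(a, b). a \<otimes> b)"
    unfolding lift_space_def prod_topology_subtopology
    by (intro continuous_map_from_subtopology continuous_map_mult)
  from continuous_map_compose[OF this continuous_map_orbit_space[of L]]
  have "continuous_map ?P (orbit_space G L) (\<lambda>(a, b). a \<otimes> b <# L)"
    by (simp add: o_def case_prod_unfold)
  then have "continuous_map ?P (orbit_space G L) (\<lambda>(a, b). a <# K <#> (b <# L))"
    by (rule continuous_map_eq) (auto simp: topspace_lift_space l_coset_mult[OF K L])
  then show "continuous_map ?P (orbit_fixed_space G L H) (\<lambda>(a, b). a <# K <#> (b <# L))"
    using set_mult_in_orbit_fixed_space[OF H K L]
    unfolding orbit_fixed_space_def[of G L H] continuous_map_in_subtopology
    by (auto simp: topspace_lift_space Pi_iff topspace_orbit_fixed_space)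
qed

end

context smooth_action
begin

section \<open>Action of cosets on fixed points\<close>

lemma continuous_map_act: "continuous_map (prod_topology (gtop G) (mtop X)) (mtop X) (\<lambda>(g, x). act g x)"
  using smooth_act by (simp add: smooth_map_def prod_manifold_def)

lemma topspace_fixed_space:
  "topspace (fixed_space X act H) = {x \<in> topspace (mtop X). \<forall>h\<in>H. act h x = x}"
  by (auto simp: fixed_space_def)

text \<open>\<open>the_elem\<close> in \<open>coset_act\<close> needs a singleton: the elements of
  aK all send y to the same point because \<open>K\<close> fixes y, and aK is nonempty because it
  contains a.\<close>

lemma coset_act_l_coset:
  assumes "subgroup K G" "a \<in> carrier G" "y \<in> topspace (fixed_space X act K)"
  shows "coset_act act (a <# K) y = act a y"
proof -
  have "act (a \<otimes> k) y = act a y" if "k \<in> K" for k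
    using that assms composition_rule[of y a k] subgroup.mem_carrier[OF assms(1)]
    by (auto simp: topspace_fixed_space)
  then have "\<forall>b\<in>a <# K. act b y = act a y"
    by (auto simp: l_coset_def)
  moreover have "a \<in> a <# K"
    using assms by (simp add: lcos_self)
  ultimately have "(\<lambda>a. act a y) ` (a <# K) = {act a y}"
    by blast
  then show ?thesis by (simp add: coset_act_def)
qed

lemma coset_act_unit:
  assumes "subgroup H G" "x \<in> topspace (fixed_space X act H)"
  shows "coset_act act H x = x"
proof -
  have "coset_act act (\<one> <# H) x = act \<one> x"
    using assms by (intro coset_act_l_coset) auto
  then show ?thesis
    using assms lcos_mult_one[OF subgroup.subset[OF assms(1)]]
    by (simp add: topspace_fixed_space subgroup.one_closed)
qed

lemma coset_act_in_fixed_space: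
  assumes "subgroup H G" "subgroup K G"
    and \<alpha>: "\<alpha> \<in> topspace (orbit_fixed_space G K H)" and y: "y \<in> topspace (fixed_space X act K)"
  shows "coset_act act \<alpha> y \<in> topspace (fixed_space X act H)"
proof -
  obtain a where a: "a \<in> carrier G" "\<alpha> = a <# K" using \<alpha> by (rule orbit_fixed_spaceE)
  have "act h (act a y) = act a y" if "h \<in> H" for h
  proof -
    have hG: "h \<in> carrier G" using that assms(1) subgroup.mem_carrier by metis
    \<comment> \<open>h fixes the coset aK, and the image of y depends only on the coset, hence
      (ha)y = ay.\<close>
    have "h \<otimes> a <# K = a <# K"
      using \<alpha> that a hG lcos_m_assoc[of K h a] subgroup.subset[OF assms(2)]
      by (simp add: topspace_orbit_fixed_space)
    then have "act (h \<otimes> a) y = act a y"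
      using coset_act_l_coset[OF assms(2) _ y] a hG by (metis m_closed)
    then show ?thesis
      using composition_rule[of y h a] a hG y by (simp add: topspace_fixed_space)
  qed
  moreover have "act a y \<in> topspace (mtop X)"
    using element_image[OF a(1)] y by (auto simp: topspace_fixed_space)
  ultimately show ?thesis
    using a coset_act_l_coset[OF assms(2) a(1) y] by (simp add: topspace_fixed_space)
qed

lemma coset_act_set_mult:
  assumes "subgroup K G" "subgroup L G"
    and \<alpha>: "\<alpha> \<in> topspace (orbit_fixed_space G K H)" and \<beta>: "\<beta> \<in> topspace (orbit_fixed_space G L K)"
    and z: "z \<in> topspace (fixed_space X act L)"
  shows "coset_act act (\<alpha> <#> \<beta>) z = coset_act act \<alpha> (coset_act act \<beta> z)"
proof -
  obtain a where a: "a \<in> carrier G" "\<alpha> = a <# K" using \<alpha> by (rule orbit_fixed_spaceE)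
  obtain b where b: "b \<in> carrier G" "\<beta> = b <# L" using \<beta> by (rule orbit_fixed_spaceE)
  have "coset_act act (\<alpha> <#> \<beta>) z = act (a \<otimes> b) z"
    using a b \<beta> z assms(1,2) by (simp add: l_coset_mult coset_act_l_coset)
  also have "\<dots> = act a (coset_act act \<beta> z)"
    using a b z assms(2) composition_rule[of z a b]
    by (simp add: coset_act_l_coset topspace_fixed_space)
  also have "\<dots> = coset_act act \<alpha> (coset_act act \<beta> z)"
    using a coset_act_l_coset[OF assms(1) a(1) coset_act_in_fixed_space[OF assms(1,2) \<beta> z]] by simp
  finally show ?thesis .
qed

text \<open>On lifts the map is the action of \<open>G\<close>. Only the first factor is a quotient,
  so the second is covered by the identity, which is open.\<close>

lemma continuous_map_coset_act:
  assumes H: "subgroup H G" and K: "subgroup K G"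
  shows "continuous_map (prod_topology (orbit_fixed_space G K H) (fixed_space X act K))
           (fixed_space X act H) (\<lambda>(\<alpha>, y). coset_act act \<alpha> y)"
proof (rule continuous_map_prod_open_quotient[OF open_map_orbit_fixed_space[OF K] topspace_orbit_fixed_space_lift,
      where q = "\<lambda>y. y"])
  let ?P = "prod_topology (lift_space K H) (fixed_space X act K)"
  have "continuous_map ?P (mtop X) (\<lambda>(a, y). act a y)"
    unfolding lift_space_def fixed_space_def prod_topology_subtopology
    by (intro continuous_map_from_subtopology continuous_map_act)
  then have "continuous_map ?P (mtop X) (\<lambda>(a, y). coset_act act (a <# K) y)"
    by (rule continuous_map_eq) (auto simp: topspace_lift_space coset_act_l_coset[OF K])
  then show "continuous_map ?P (fixed_space X act H) (\<lambda>(a, y). coset_act act (a <# K) y)"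
    using coset_act_in_fixed_space[OF H K]
    unfolding fixed_space_def[of X act H] continuous_map_in_subtopology
    by (auto simp: topspace_lift_space Pi_iff topspace_fixed_space)
qed (auto simp: open_map_def)

end

section \<open>The 2-category\<close>

context smooth_action
begin

section \<open>Representatives of arrows and 2-cells\<close>

abbreviation "\<C> \<equiv> Pi_two_cat G X act"
abbreviation "fix_class H \<equiv> path_class (fixed_space X act H)"
abbreviation "orbit_class K H \<equiv> path_class (orbit_fixed_space G K H)"

definition is_arr where
  "is_arr H x K y \<alpha> \<gamma> \<longleftrightarrow>
     \<alpha> \<in> topspace (orbit_fixed_space G K H) \<and>
     pathin (fixed_space X act H) \<gamma> \<and> \<gamma> 0 = x \<and> \<gamma> 1 = coset_act act \<alpha> y"

text \<open>The homotopy condition is imposed on the given paths \<gamma> and \<gamma>', whereas a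
  2-cell of \<open>Pi_two_cat\<close> asks for it on some representatives of their classes.
  \<open>Pi_cellI\<close> and \<open>Pi_cellE\<close> pass between the two forms.\<close>

definition is_cell where
  "is_cell H K y \<alpha> \<gamma> \<alpha>' \<gamma>' \<sigma> \<longleftrightarrow>
     pathin (orbit_fixed_space G K H) \<sigma> \<and> \<sigma> 0 = \<alpha> \<and> \<sigma> 1 = \<alpha>' \<and>
     path_homotopic (fixed_space X act H) (join \<gamma> (\<lambda>t. coset_act act (\<sigma> t) y)) \<gamma>'"

lemma pathin_coset_act_left:
  assumes "subgroup H G" "subgroup K G" and y: "y \<in> topspace (fixed_space X act K)"
    and "pathin (orbit_fixed_space G K H) \<sigma>"
  shows "pathin (fixed_space X act H) (\<lambda>t. coset_act act (\<sigma> t) y)"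
  using pathin_image[OF assms(4)
      continuous_map_prod_section(1)[OF continuous_map_coset_act[OF assms(1,2)] y]] .

lemma
  assumes "subgroup H G" "subgroup K G" and \<alpha>: "\<alpha> \<in> topspace (orbit_fixed_space G K H)"
  shows pathin_coset_act_right:
      "pathin (fixed_space X act K) \<zeta> \<Longrightarrow> pathin (fixed_space X act H) (\<lambda>t. coset_act act \<alpha> (\<zeta> t))"
    and path_homotopic_coset_act_right:
      "path_homotopic (fixed_space X act K) \<zeta> \<zeta>' \<Longrightarrow>
       path_homotopic (fixed_space X act H) (\<lambda>t. coset_act act \<alpha> (\<zeta> t)) (\<lambda>t. coset_act act \<alpha> (\<zeta>' t))"
  using continuous_map_prod_section(2)[OF continuous_map_coset_act[OF assms(1,2)] \<alpha>]
    pathin_image path_homotopic_image by blast+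

lemma
  assumes "subgroup H G" "subgroup K G" "subgroup L G"
    and \<beta>: "\<beta> \<in> topspace (orbit_fixed_space G L K)"
  shows pathin_set_mult_left:
      "pathin (orbit_fixed_space G K H) \<sigma> \<Longrightarrow> pathin (orbit_fixed_space G L H) (\<lambda>t. \<sigma> t <#> \<beta>)"
    and path_homotopic_set_mult_left:
      "path_homotopic (orbit_fixed_space G K H) \<sigma> \<sigma>' \<Longrightarrow>
       path_homotopic (orbit_fixed_space G L H) (\<lambda>t. \<sigma> t <#> \<beta>) (\<lambda>t. \<sigma>' t <#> \<beta>)"
  using continuous_map_prod_section(1)[OF continuous_map_set_mult[OF assms(1,2,3)] \<beta>]
    pathin_image path_homotopic_image by blast+

lemma
  assumes "subgroup H G" "subgroup K G" "subgroup L G"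
    and \<alpha>: "\<alpha> \<in> topspace (orbit_fixed_space G K H)"
  shows pathin_set_mult_right:
      "pathin (orbit_fixed_space G L K) \<omega> \<Longrightarrow> pathin (orbit_fixed_space G L H) (\<lambda>t. \<alpha> <#> \<omega> t)"
    and path_homotopic_set_mult_right:
      "path_homotopic (orbit_fixed_space G L K) \<omega> \<omega>' \<Longrightarrow>
       path_homotopic (orbit_fixed_space G L H) (\<lambda>t. \<alpha> <#> \<omega> t) (\<lambda>t. \<alpha> <#> \<omega>' t)"
  using continuous_map_prod_section(2)[OF continuous_map_set_mult[OF assms(1,2,3)] \<alpha>]
    pathin_image path_homotopic_image by blast+

lemma is_arrD:
  assumes "is_arr H x K y \<alpha> \<gamma>"
  shows "\<alpha> \<in> topspace (orbit_fixed_space G K H)" "pathin (fixed_space X act H) \<gamma>"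
    "\<gamma> 0 = x" "\<gamma> 1 = coset_act act \<alpha> y"
  using assms by (simp_all add: is_arr_def)

lemma is_cellD:
  assumes "is_cell H K y \<alpha> \<gamma> \<alpha>' \<gamma>' \<sigma>"
  shows "pathin (orbit_fixed_space G K H) \<sigma>" "\<sigma> 0 = \<alpha>" "\<sigma> 1 = \<alpha>'"
    "path_homotopic (fixed_space X act H) (join \<gamma> (\<lambda>t. coset_act act (\<sigma> t) y)) \<gamma>'"
  using assms by (simp_all add: is_cell_def)

lemma Pi_obE:
  assumes "A \<in> ob \<C>"
  obtains H x where "A = (H, x)" "subgroup H G" "closedin (gtop G) H" "x \<in> topspace (fixed_space X act H)"
  using assms by (auto simp: Pi_two_cat_def)

lemma Pi_arrI:
  "is_arr H x K y \<alpha> \<gamma> \<Longrightarrow>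
   (\<alpha>, fix_class H \<gamma>) \<in> arr \<C> (H, x) (K, y)"
  by (auto simp: Pi_two_cat_def is_arr_def)

lemma Pi_arrE:
  assumes "f \<in> arr \<C> (H, x) (K, y)"
  obtains \<alpha> \<gamma> where "f = (\<alpha>, fix_class H \<gamma>)" "is_arr H x K y \<alpha> \<gamma>"
  using assms by (auto simp: Pi_two_cat_def is_arr_def)

lemma Pi_cellI:
  assumes "is_cell H K y \<alpha> \<gamma> \<alpha>' \<gamma>' \<sigma>"
    and "pathin (fixed_space X act H) \<gamma>"
  shows "orbit_class K H \<sigma> \<in>
     cell \<C> (H, x) (K, y) (\<alpha>, fix_class H \<gamma>)
       (\<alpha>', fix_class H \<gamma>')"
proof -
  have "\<gamma> \<in> fix_class H \<gamma>" "\<gamma>' \<in> fix_class H \<gamma>'"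
    using assms path_homotopicD(2)[OF is_cellD(4)[OF assms(1)]]
    by (auto simp: path_class_def intro: path_homotopic_refl)
  then show ?thesis
    using assms by (auto simp: Pi_two_cat_def is_cell_def)
qed

text \<open>The representatives hidden in the cell are exchanged for the given ones, since
  concatenation respects homotopy. Several cells sharing an arrow can thus be handled with a single
  choice of path for that arrow.\<close>

lemma Pi_cellE:
  assumes "s \<in> cell \<C> (H, x) (K, y) (\<alpha>, fix_class H \<gamma>)
       (\<alpha>', fix_class H \<gamma>')"
    and arr: "is_arr H x K y \<alpha> \<gamma>"
    and HK: "subgroup H G" "subgroup K G" "y \<in> topspace (fixed_space X act K)"
  obtains \<sigma> where "s = orbit_class K H \<sigma>" "is_cell H K y \<alpha> \<gamma> \<alpha>' \<gamma>' \<sigma>"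
proof -
  let ?F = "fixed_space X act H"
  obtain \<sigma> \<gamma>1 \<gamma>2 where \<sigma>: "s = orbit_class K H \<sigma>"
      "pathin (orbit_fixed_space G K H) \<sigma>" "\<sigma> 0 = \<alpha>" "\<sigma> 1 = \<alpha>'"
    and \<gamma>: "path_homotopic ?F \<gamma> \<gamma>1" "path_homotopic ?F \<gamma>' \<gamma>2"
      "path_homotopic ?F (join \<gamma>1 (\<lambda>t. coset_act act (\<sigma> t) y)) \<gamma>2"
    using assms(1) by (auto simp: Pi_two_cat_def path_class_def)
  have "path_homotopic ?F (join \<gamma> (\<lambda>t. coset_act act (\<sigma> t) y)) (join \<gamma>1 (\<lambda>t. coset_act act (\<sigma> t) y))"
    using \<gamma>(1) \<sigma> is_arrD(4)[OF arr]
    by (intro path_homotopic_join path_homotopic_refl pathin_coset_act_left[OF HK]) auto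
  also note \<gamma>(3)
  also note path_homotopic_sym[OF \<gamma>(2)]
  finally show ?thesis
    using that \<sigma> by (simp add: is_cell_def)
qed

section \<open>The operations on representatives\<close>

lemma Pi_id1: "id1 \<C> (H, x) = (H, fix_class H (\<lambda>_. x))"
  by (simp add: Pi_two_cat_def)

lemma Pi_id2:
  "id2 \<C> (H, x) (K, y) (\<alpha>, c) = orbit_class K H (\<lambda>_. \<alpha>)"
  by (simp add: Pi_two_cat_def)

lemma Pi_comp1:
  assumes "subgroup H G" "subgroup K G" and f: "is_arr H x K y \<alpha> \<gamma>" and g: "is_arr K y L z \<beta> \<zeta>"
  shows "comp1 \<C> (H, x) (K, y) (L, z)
      (\<alpha>, fix_class H \<gamma>) (\<beta>, fix_class K \<zeta>) =
    (\<alpha> <#> \<beta>, fix_class H (join \<gamma> (\<lambda>t. coset_act act \<alpha> (\<zeta> t))))"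
  using is_arrD[OF f] is_arrD[OF g]
    UN_path_class2[of "fixed_space X act H" \<gamma> "fixed_space X act K" \<zeta> "fixed_space X act H"
      "\<lambda>\<gamma> \<zeta>. join \<gamma> (\<lambda>t. coset_act act \<alpha> (\<zeta> t))"]
  by (simp add: Pi_two_cat_def path_homotopic_join path_homotopic_coset_act_right[OF assms(1,2)])

lemma Pi_vcomp:
  assumes "is_cell H K y \<alpha> \<gamma> \<alpha>' \<gamma>' \<sigma>" "is_cell H K y \<alpha>' \<gamma>' \<alpha>'' \<gamma>'' \<tau>"
  shows "vcomp \<C> (H, x) (K, y) f f' f''
      (orbit_class K H \<sigma>) (orbit_class K H \<tau>) =
    orbit_class K H (join \<sigma> \<tau>)"
  using is_cellD[OF assms(1)] is_cellD[OF assms(2)]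
    UN_path_class2[of "orbit_fixed_space G K H" \<sigma> "orbit_fixed_space G K H" \<tau> "orbit_fixed_space G K H" join]
  by (simp add: Pi_two_cat_def path_homotopic_join)

lemma Pi_hcomp:
  assumes HKL: "subgroup H G" "subgroup K G" "subgroup L G"
    and s: "is_cell H K y \<alpha> \<gamma> \<alpha>' \<gamma>' \<sigma>" and w: "is_cell K L z \<beta> \<zeta> \<beta>' \<zeta>' \<omega>"
  shows "hcomp \<C> (H, x) (K, y) (L, z) (\<alpha>, c) (\<alpha>', c') (\<beta>, d) (\<beta>', d')
      (orbit_class K H \<sigma>) (orbit_class L K \<omega>) =
    orbit_class L H (join (\<lambda>t. \<sigma> t <#> \<beta>) (\<lambda>t. \<alpha>' <#> \<omega> t))"
proof -
  \<comment> \<open>\<alpha>' is the end of \<sigma> and \<beta> the start of \<omega>, so both lie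
    in the fixed spaces, where multiplication by them is continuous and preserves
    homotopies.\<close>
  have "\<alpha>' \<in> topspace (orbit_fixed_space G K H)" "\<beta> \<in> topspace (orbit_fixed_space G L K)"
    using is_cellD(1-3)[OF s] is_cellD(1-3)[OF w] path_start_in_topspace path_finish_in_topspace by metis+
  then show ?thesis
    using is_cellD[OF s] is_cellD[OF w]
      UN_path_class2[of "orbit_fixed_space G K H" \<sigma> "orbit_fixed_space G L K" \<omega> "orbit_fixed_space G L H"
        "\<lambda>\<sigma> \<omega>. join (\<lambda>t. \<sigma> t <#> \<beta>) (\<lambda>t. \<alpha>' <#> \<omega> t)"]
    by (simp add: Pi_two_cat_def path_homotopic_join path_homotopic_set_mult_left[OF HKL]
        path_homotopic_set_mult_right[OF HKL])
qed

lemma is_arr_id: "subgroup H G \<Longrightarrow> x \<in> topspace (fixed_space X act H) \<Longrightarrow> is_arr H x H x H (\<lambda>_. x)"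
  by (simp add: is_arr_def unit_in_orbit_fixed_space coset_act_unit)

lemma is_arr_comp:
  assumes HKL: "subgroup H G" "subgroup K G" "subgroup L G" and z: "z \<in> topspace (fixed_space X act L)"
    and f: "is_arr H x K y \<alpha> \<gamma>" and g: "is_arr K y L z \<beta> \<zeta>"
  shows "is_arr H x L z (\<alpha> <#> \<beta>) (join \<gamma> (\<lambda>t. coset_act act \<alpha> (\<zeta> t)))"
  using is_arrD[OF f] is_arrD[OF g] set_mult_in_orbit_fixed_space[OF HKL] coset_act_set_mult[OF HKL(2,3), where H = H] z
  by (simp add: is_arr_def pathin_join pathin_coset_act_right[OF HKL(1,2)])

lemma is_cell_id:
  assumes "is_arr H x K y \<alpha> \<gamma>"
  shows "is_cell H K y \<alpha> \<gamma> \<alpha> \<gamma> (\<lambda>_. \<alpha>)"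
  using is_arrD[OF assms] by (simp add: is_cell_def path_homotopic_join_const_right)

lemma is_cell_vcomp:
  assumes HK: "subgroup H G" "subgroup K G" and y: "y \<in> topspace (fixed_space X act K)"
    and f: "is_arr H x K y \<alpha> \<gamma>"
    and s: "is_cell H K y \<alpha> \<gamma> \<alpha>' \<gamma>' \<sigma>" and t: "is_cell H K y \<alpha>' \<gamma>' \<alpha>'' \<gamma>'' \<tau>"
  shows "is_cell H K y \<alpha> \<gamma> \<alpha>'' \<gamma>'' (join \<sigma> \<tau>)"
proof -
  let ?F = "fixed_space X act H"
  let ?s = "\<lambda>t. coset_act act (\<sigma> t) y" and ?t = "\<lambda>t. coset_act act (\<tau> t) y"
  note facts = is_arrD[OF f] is_cellD[OF s] is_cellD[OF t]
    pathin_coset_act_left[OF HK y is_cellD(1)[OF s]] pathin_coset_act_left[OF HK y is_cellD(1)[OF t]]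
  have "path_homotopic ?F (join \<gamma> (join ?s ?t)) (join (join \<gamma> ?s) ?t)"
    using facts by (intro path_homotopic_sym[OF path_homotopic_assoc]) auto
  also have "path_homotopic ?F \<dots> (join \<gamma>' ?t)"
    using facts by (intro path_homotopic_join path_homotopic_refl) auto
  also have "path_homotopic ?F \<dots> \<gamma>''"
    using facts by simp
  finally show ?thesis
    using facts by (simp add: is_cell_def image_join[of "\<lambda>\<alpha>. coset_act act \<alpha> y"] pathin_join)
qed

text \<open>The path to be deformed is (\<gamma> * \<alpha>\<zeta>) * (\<sigma>\<beta>z *
  \<alpha>'\<omega>z). Replacing its middle pair by \<sigma>y * \<alpha>'\<zeta> gives (\<gamma> *
  \<sigma>y) * \<alpha>'(\<zeta> * \<omega>z), and the conditions on \<sigma> and \<omega> deform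
  the two factors to \<gamma>' and \<alpha>'\<zeta>'.\<close>

lemma is_cell_hcomp:
  assumes HKL: "subgroup H G" "subgroup K G" "subgroup L G" and yz: "y \<in> topspace (fixed_space X act K)"
    "z \<in> topspace (fixed_space X act L)"
    and f: "is_arr H x K y \<alpha> \<gamma>" and f': "is_arr H x K y \<alpha>' \<gamma>'"
    and g: "is_arr K y L z \<beta> \<zeta>" and g': "is_arr K y L z \<beta>' \<zeta>'"
    and s: "is_cell H K y \<alpha> \<gamma> \<alpha>' \<gamma>' \<sigma>" and w: "is_cell K L z \<beta> \<zeta> \<beta>' \<zeta>' \<omega>"
  shows "is_cell H L z (\<alpha> <#> \<beta>) (join \<gamma> (\<lambda>t. coset_act act \<alpha> (\<zeta> t)))
     (\<alpha>' <#> \<beta>') (join \<gamma>' (\<lambda>t. coset_act act \<alpha>' (\<zeta>' t)))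
     (join (\<lambda>t. \<sigma> t <#> \<beta>) (\<lambda>t. \<alpha>' <#> \<omega> t))"
proof -
  let ?F = "fixed_space X act H" and ?O = "orbit_fixed_space G L H"
  note arrs = is_arrD[OF f] is_arrD[OF f'] is_arrD[OF g] is_arrD[OF g']
  note cells = is_cellD[OF s] is_cellD[OF w]
  note act = coset_act_in_fixed_space[OF HKL(1,2)] coset_act_in_fixed_space[OF HKL(2,3)]
  let ?c = "coset_act act"
  have \<beta>z: "?c \<beta> z \<in> topspace (fixed_space X act K)" using act arrs yz by blast
  have p1: "pathin ?F (\<lambda>t. ?c \<alpha> (\<zeta> t))" "pathin ?F (\<lambda>t. ?c \<alpha>' (\<zeta> t))"
    using arrs pathin_coset_act_right[OF HKL(1,2)] by blast+
  have p2: "pathin ?F (\<lambda>t. ?c (\<sigma> t) (?c \<beta> z))" "pathin ?F (\<lambda>t. ?c (\<sigma> t) y)"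
    using cells \<beta>z yz pathin_coset_act_left[OF HKL(1,2)] by blast+
  have p3: "pathin (fixed_space X act K) (\<lambda>t. ?c (\<omega> t) z)"
    using cells yz pathin_coset_act_left[OF HKL(2,3)] by blast
  have p4: "pathin ?F (\<lambda>t. ?c \<alpha>' (?c (\<omega> t) z))"
    using p3 arrs pathin_coset_act_right[OF HKL(1,2)] by blast
  have o1: "pathin ?O (\<lambda>t. \<sigma> t <#> \<beta>)"
    using cells arrs pathin_set_mult_left[OF HKL] by blast
  have o2: "pathin ?O (\<lambda>t. \<alpha>' <#> \<omega> t)"
    using cells arrs pathin_set_mult_right[OF HKL] by blast
  \<comment> \<open>\<zeta> runs from y to \<beta>z and \<sigma> from \<alpha> to \<alpha>', so
    these are the two ways from \<alpha>y to \<alpha>'\<beta>z around the square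
    \<sigma>(s)\<zeta>(t).\<close>
  have sq: "path_homotopic ?F (join (\<lambda>t. ?c \<alpha> (\<zeta> t)) (\<lambda>t. ?c (\<sigma> t) (?c \<beta> z)))
      (join (\<lambda>t. ?c (\<sigma> t) y) (\<lambda>t. ?c \<alpha>' (\<zeta> t)))"
    using path_homotopic_sym[OF path_homotopic_square[OF continuous_map_coset_act[OF HKL(1,2)],
        of \<sigma> \<zeta>]] cells arrs by simp
  have "path_homotopic ?F
      (join (join \<gamma> (\<lambda>t. ?c \<alpha> (\<zeta> t))) (\<lambda>t. ?c (join (\<lambda>t. \<sigma> t <#> \<beta>) (\<lambda>t. \<alpha>' <#> \<omega> t) t) z))
      (join (join \<gamma> (\<lambda>t. ?c \<alpha> (\<zeta> t))) (join (\<lambda>t. ?c (\<sigma> t) (?c \<beta> z)) (\<lambda>t. ?c \<alpha>' (?c (\<omega> t) z))))"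
  proof (intro path_homotopic_join path_homotopic_refl pathin_join)
    \<comment> \<open>Associativity of the action needs \<sigma>(t) to lie in (G/K)^H, which is
      known for t in the unit interval; hence a homotopy instead of an equality of
      functions.\<close>
    have "path_homotopic ?F (\<lambda>t. ?c (\<sigma> t <#> \<beta>) z) (\<lambda>t. ?c (\<sigma> t) (?c \<beta> z))"
      using pathin_in_topspace[OF cells(1)] arrs yz coset_act_set_mult[OF HKL(2,3), where H = H]
      by (intro path_homotopic_sym[OF path_homotopic_eq[OF p2(1)]]) auto
    moreover have "path_homotopic ?F (\<lambda>t. ?c (\<alpha>' <#> \<omega> t) z) (\<lambda>t. ?c \<alpha>' (?c (\<omega> t) z))"
      using pathin_in_topspace[OF cells(5)] arrs yz coset_act_set_mult[OF HKL(2,3), where H = H]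
      by (intro path_homotopic_sym[OF path_homotopic_eq[OF p4]]) auto
    ultimately show "path_homotopic ?F (\<lambda>t. ?c (join (\<lambda>t. \<sigma> t <#> \<beta>) (\<lambda>t. \<alpha>' <#> \<omega> t) t) z)
        (join (\<lambda>t. ?c (\<sigma> t) (?c \<beta> z)) (\<lambda>t. ?c \<alpha>' (?c (\<omega> t) z)))"
      unfolding image_join[of "\<lambda>\<alpha>. ?c \<alpha> z"] using cells by (intro path_homotopic_join) auto
  qed (use arrs cells p1 coset_act_set_mult[OF HKL(2,3), where H = H] yz in auto)
  also have "path_homotopic ?F \<dots>
      (join (join \<gamma> (\<lambda>t. ?c (\<sigma> t) y)) (join (\<lambda>t. ?c \<alpha>' (\<zeta> t)) (\<lambda>t. ?c \<alpha>' (?c (\<omega> t) z))))"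
    using arrs cells p1 p2 p4 sq by (intro path_homotopic_middle_four) auto
  also have "path_homotopic ?F \<dots> (join \<gamma>' (\<lambda>t. ?c \<alpha>' (\<zeta>' t)))"
    unfolding image_join[of "?c \<alpha>'", symmetric]
    using arrs cells by (intro path_homotopic_join path_homotopic_coset_act_right[OF HKL(1,2)]) auto
  finally show ?thesis
    using cells o1 o2 by (simp add: is_cell_def pathin_join)
qed

section \<open>The equational axioms of the 2-category\<close>

lemma Pi_comp1_id_left:
  assumes H: "subgroup H G" and x: "x \<in> topspace (fixed_space X act H)"
    and f: "is_arr H x K y \<alpha> \<gamma>"
  shows "comp1 \<C> (H, x) (H, x) (K, y) (id1 \<C> (H, x)) (\<alpha>, fix_class H \<gamma>) = (\<alpha>, fix_class H \<gamma>)"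
proof -
  note f' = is_arrD[OF f]
  have eq: "path_homotopic (fixed_space X act H) (\<lambda>t. coset_act act H (\<gamma> t)) \<gamma>"
    using f'(2) pathin_in_topspace[OF f'(2)] coset_act_unit[OF H]
    by (intro path_homotopic_sym[OF path_homotopic_eq]) auto
  have "path_homotopic (fixed_space X act H) (join (\<lambda>_. x) (\<lambda>t. coset_act act H (\<gamma> t))) (join (\<lambda>_. x) \<gamma>)"
    using eq f' x coset_act_unit[OF H] by (intro path_homotopic_join path_homotopic_refl) auto
  also have "path_homotopic (fixed_space X act H) \<dots> \<gamma>"
    using f' by (intro path_homotopic_join_const_left) auto
  finally show ?thesis
    using f' unfolding Pi_id1 Pi_comp1[OF H H is_arr_id[OF H x] f]
    by (simp add: path_class_eqI set_mult_unit_left[OF H])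
qed

lemma Pi_comp1_id_right:
  assumes HK: "subgroup H G" "subgroup K G" and y: "y \<in> topspace (fixed_space X act K)"
    and f: "is_arr H x K y \<alpha> \<gamma>"
  shows "comp1 \<C> (H, x) (K, y) (K, y) (\<alpha>, fix_class H \<gamma>) (id1 \<C> (K, y)) = (\<alpha>, fix_class H \<gamma>)"
  using is_arrD[OF f] unfolding Pi_id1 Pi_comp1[OF HK f is_arr_id[OF HK(2) y]]
  by (simp add: path_class_eqI path_homotopic_join_const_right set_mult_unit_right[OF HK(2)])

text \<open>Both composites run through \<gamma>, \<alpha>\<zeta> and \<alpha>\<beta>\<xi>. They
  differ in the bracketing of the concatenation and in reading the last piece as
  (\<alpha>\<beta>)\<xi> or as \<alpha>(\<beta>\<xi>).\<close>

lemma Pi_comp1_assoc: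
  assumes HKL: "subgroup H G" "subgroup K G" "subgroup L G" and M: "subgroup M G"
    and z: "z \<in> topspace (fixed_space X act L)" and v: "v \<in> topspace (fixed_space X act M)"
    and f: "is_arr H x K y \<alpha> \<gamma>" and g: "is_arr K y L z \<beta> \<zeta>" and h: "is_arr L z M v \<eta> \<xi>"
  shows "comp1 \<C> (H, x) (L, z) (M, v)
      (comp1 \<C> (H, x) (K, y) (L, z) (\<alpha>, fix_class H \<gamma>) (\<beta>, fix_class K \<zeta>)) (\<eta>, fix_class L \<xi>) =
    comp1 \<C> (H, x) (K, y) (M, v) (\<alpha>, fix_class H \<gamma>)
      (comp1 \<C> (K, y) (L, z) (M, v) (\<beta>, fix_class K \<zeta>) (\<eta>, fix_class L \<xi>))"
proof -
  note f' = is_arrD[OF f] and g' = is_arrD[OF g] and h' = is_arrD[OF h]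
  let ?c = "coset_act act" and ?F = "fixed_space X act H"
  have p: "pathin ?F (\<lambda>t. ?c \<alpha> (\<zeta> t))" "pathin ?F (\<lambda>t. ?c \<alpha> (?c \<beta> (\<xi> t)))"
    using f' g' h' pathin_coset_act_right[OF HKL(1,2)] pathin_coset_act_right[OF HKL(2,3)] by blast+
  have eq: "path_homotopic ?F (\<lambda>t. ?c (\<alpha> <#> \<beta>) (\<xi> t)) (\<lambda>t. ?c \<alpha> (?c \<beta> (\<xi> t)))"
    using pathin_in_topspace[OF h'(2)] f' g' coset_act_set_mult[OF HKL(2,3), where H = H]
    by (intro path_homotopic_sym[OF path_homotopic_eq[OF p(2)]]) auto
  have "path_homotopic ?F (join (join \<gamma> (\<lambda>t. ?c \<alpha> (\<zeta> t))) (\<lambda>t. ?c (\<alpha> <#> \<beta>) (\<xi> t)))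
      (join (join \<gamma> (\<lambda>t. ?c \<alpha> (\<zeta> t))) (\<lambda>t. ?c \<alpha> (?c \<beta> (\<xi> t))))"
    using eq p f' g' h' z coset_act_set_mult[OF HKL(2,3), where H = H]
    by (intro path_homotopic_join path_homotopic_refl pathin_join) auto
  also have "path_homotopic ?F \<dots> (join \<gamma> (join (\<lambda>t. ?c \<alpha> (\<zeta> t)) (\<lambda>t. ?c \<alpha> (?c \<beta> (\<xi> t)))))"
    using p f' g' h' by (intro path_homotopic_assoc) auto
  finally have "path_homotopic ?F (join (join \<gamma> (\<lambda>t. ?c \<alpha> (\<zeta> t))) (\<lambda>t. ?c (\<alpha> <#> \<beta>) (\<xi> t)))
      (join \<gamma> (\<lambda>t. ?c \<alpha> (join \<zeta> (\<lambda>t. ?c \<beta> (\<xi> t)) t)))"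
    by (simp add: image_join[of "?c \<alpha>"])
  moreover have "\<alpha> <#> \<beta> <#> \<eta> = \<alpha> <#> (\<beta> <#> \<eta>)"
    by (rule set_mult_orbit_fixed_space_assoc[OF HKL(2,3) M f'(1) g'(1) h'(1)])
  ultimately show ?thesis
    unfolding Pi_comp1[OF HKL(1,2) f g] Pi_comp1[OF HKL(2,3) g h]
      Pi_comp1[OF HKL(1,3) is_arr_comp[OF HKL z f g] h]
      Pi_comp1[OF HKL(1,2) f is_arr_comp[OF HKL(2,3) M v g h]]
    by (simp add: path_class_eqI)
qed

lemma Pi_vcomp_id_left:
  assumes s: "is_cell H K y \<alpha> \<gamma> \<alpha>' \<gamma>' \<sigma>" and f: "is_arr H x K y \<alpha> \<gamma>"
  shows "vcomp \<C> (H, x) (K, y) f f' f'' (id2 \<C> (H, x) (K, y) (\<alpha>, c)) (orbit_class K H \<sigma>) = orbit_class K H \<sigma>"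
  using is_cellD[OF s] unfolding Pi_id2 Pi_vcomp[OF is_cell_id[OF f] s]
  by (intro path_class_eqI path_homotopic_join_const_left) auto

lemma Pi_vcomp_id_right:
  assumes s: "is_cell H K y \<alpha> \<gamma> \<alpha>' \<gamma>' \<sigma>" and f': "is_arr H x K y \<alpha>' \<gamma>'"
  shows "vcomp \<C> (H, x) (K, y) f f' f'' (orbit_class K H \<sigma>) (id2 \<C> (H, x) (K, y) (\<alpha>', c)) = orbit_class K H \<sigma>"
  using is_cellD[OF s] unfolding Pi_id2 Pi_vcomp[OF s is_cell_id[OF f']]
  by (intro path_class_eqI path_homotopic_join_const_right) auto

lemma Pi_vcomp_assoc:
  assumes HK: "subgroup H G" "subgroup K G" and y: "y \<in> topspace (fixed_space X act K)"
    and s: "is_cell H K y \<alpha> \<gamma> \<alpha>' \<gamma>' \<sigma>" and t: "is_cell H K y \<alpha>' \<gamma>' \<alpha>'' \<gamma>'' \<tau>"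
    and u: "is_cell H K y \<alpha>'' \<gamma>'' \<alpha>3 \<gamma>3 \<upsilon>"
    and f: "is_arr H x K y \<alpha> \<gamma>" and f': "is_arr H x K y \<alpha>' \<gamma>'"
  shows "vcomp \<C> (H, x) (K, y) f1 f2 f3
      (vcomp \<C> (H, x) (K, y) f4 f5 f6 (orbit_class K H \<sigma>) (orbit_class K H \<tau>)) (orbit_class K H \<upsilon>) =
    vcomp \<C> (H, x) (K, y) f7 f8 f9 (orbit_class K H \<sigma>)
      (vcomp \<C> (H, x) (K, y) f10 f11 f12 (orbit_class K H \<tau>) (orbit_class K H \<upsilon>))"
  using is_cellD[OF s] is_cellD[OF t] is_cellD[OF u]
  unfolding Pi_vcomp[OF s t] Pi_vcomp[OF t u]
    Pi_vcomp[OF is_cell_vcomp[OF HK y f s t] u] Pi_vcomp[OF s is_cell_vcomp[OF HK y f' t u]]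
  by (intro path_class_eqI path_homotopic_assoc) auto

lemma Pi_hcomp_id2:
  assumes HKL: "subgroup H G" "subgroup K G" "subgroup L G"
    and f: "is_arr H x K y \<alpha> \<gamma>" and g: "is_arr K y L z \<beta> \<zeta>"
  shows "hcomp \<C> (H, x) (K, y) (L, z) (\<alpha>, fix_class H \<gamma>) (\<alpha>, fix_class H \<gamma>)
      (\<beta>, fix_class K \<zeta>) (\<beta>, fix_class K \<zeta>)
      (id2 \<C> (H, x) (K, y) (\<alpha>, fix_class H \<gamma>)) (id2 \<C> (K, y) (L, z) (\<beta>, fix_class K \<zeta>)) =
    id2 \<C> (H, x) (L, z) (comp1 \<C> (H, x) (K, y) (L, z) (\<alpha>, fix_class H \<gamma>) (\<beta>, fix_class K \<zeta>))"
  using is_arrD(1)[OF f] is_arrD(1)[OF g] set_mult_in_orbit_fixed_space[OF HKL]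
  unfolding Pi_comp1[OF HKL(1,2) f g] Pi_id2 Pi_hcomp[OF HKL is_cell_id[OF f] is_cell_id[OF g]]
  by (intro path_class_eqI path_homotopic_join_const_right) auto

text \<open>Up to bracketing, the left side is \<sigma>\<beta> * \<sigma>'\<beta> *
  \<alpha>''\<omega> * \<alpha>''\<omega>' and the right side is \<sigma>\<beta> * \<alpha>'\<omega>
  * \<sigma>'\<beta>' * \<alpha>''\<omega>'. The middle pairs are the two ways around the square
  \<sigma>'(s)\<omega>(t).\<close>

lemma Pi_interchange:
  assumes HKL: "subgroup H G" "subgroup K G" "subgroup L G"
    and y: "y \<in> topspace (fixed_space X act K)" and z: "z \<in> topspace (fixed_space X act L)"
    and f: "is_arr H x K y \<alpha> \<gamma>" "is_arr H x K y \<alpha>' \<gamma>'" "is_arr H x K y \<alpha>'' \<gamma>''"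
    and g: "is_arr K y L z \<beta> \<zeta>" "is_arr K y L z \<beta>' \<zeta>'" "is_arr K y L z \<beta>'' \<zeta>''"
    and s: "is_cell H K y \<alpha> \<gamma> \<alpha>' \<gamma>' \<sigma>" and s': "is_cell H K y \<alpha>' \<gamma>' \<alpha>'' \<gamma>'' \<sigma>'"
    and w: "is_cell K L z \<beta> \<zeta> \<beta>' \<zeta>' \<omega>" and w': "is_cell K L z \<beta>' \<zeta>' \<beta>'' \<zeta>'' \<omega>'"
  shows "hcomp \<C> (H, x) (K, y) (L, z) (\<alpha>, fix_class H \<gamma>) (\<alpha>'', fix_class H \<gamma>'')
      (\<beta>, fix_class K \<zeta>) (\<beta>'', fix_class K \<zeta>'')
      (vcomp \<C> (H, x) (K, y) f1 f2 f3 (orbit_class K H \<sigma>) (orbit_class K H \<sigma>'))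
      (vcomp \<C> (K, y) (L, z) g1 g2 g3 (orbit_class L K \<omega>) (orbit_class L K \<omega>')) =
    vcomp \<C> (H, x) (L, z) h1 h2 h3
      (hcomp \<C> (H, x) (K, y) (L, z) (\<alpha>, fix_class H \<gamma>) (\<alpha>', fix_class H \<gamma>')
        (\<beta>, fix_class K \<zeta>) (\<beta>', fix_class K \<zeta>') (orbit_class K H \<sigma>) (orbit_class L K \<omega>))
      (hcomp \<C> (H, x) (K, y) (L, z) (\<alpha>', fix_class H \<gamma>') (\<alpha>'', fix_class H \<gamma>'')
        (\<beta>', fix_class K \<zeta>') (\<beta>'', fix_class K \<zeta>'') (orbit_class K H \<sigma>') (orbit_class L K \<omega>'))"
proof -
  note cells = is_cellD[OF s] is_cellD[OF s'] is_cellD[OF w] is_cellD[OF w']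
  note arrs = f[THEN is_arrD(1)] g[THEN is_arrD(1)]
  let ?O = "orbit_fixed_space G L H"
  have "path_homotopic ?O (join (\<lambda>t. \<sigma>' t <#> \<beta>) (\<lambda>t. \<alpha>'' <#> \<omega> t)) (join (\<lambda>t. \<alpha>' <#> \<omega> t) (\<lambda>t. \<sigma>' t <#> \<beta>'))"
    using path_homotopic_square[OF continuous_map_set_mult[OF HKL], of \<sigma>' \<omega>] cells by simp
  then have "path_homotopic ?O
      (join (join (\<lambda>t. \<sigma> t <#> \<beta>) (\<lambda>t. \<sigma>' t <#> \<beta>)) (join (\<lambda>t. \<alpha>'' <#> \<omega> t) (\<lambda>t. \<alpha>'' <#> \<omega>' t)))
      (join (join (\<lambda>t. \<sigma> t <#> \<beta>) (\<lambda>t. \<alpha>' <#> \<omega> t)) (join (\<lambda>t. \<sigma>' t <#> \<beta>') (\<lambda>t. \<alpha>'' <#> \<omega>' t)))"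
    using cells arrs
    by (intro path_homotopic_middle_four pathin_set_mult_left[OF HKL] pathin_set_mult_right[OF HKL]) auto
  then show ?thesis
    unfolding Pi_vcomp[OF s s'] Pi_vcomp[OF w w'] Pi_hcomp[OF HKL s w] Pi_hcomp[OF HKL s' w']
      Pi_hcomp[OF HKL is_cell_vcomp[OF HKL(1,2) y f(1) s s'] is_cell_vcomp[OF HKL(2,3) z g(1) w w']]
      Pi_vcomp[OF is_cell_hcomp[OF HKL y z f(1,2) g(1,2) s w] is_cell_hcomp[OF HKL y z f(2,3) g(2,3) s' w']]
    by (intro path_class_eqI) (simp add: image_join[of "\<lambda>\<alpha>. \<alpha> <#> \<beta>"] image_join[of "\<lambda>\<beta>. \<alpha>'' <#> \<beta>"])
qed

lemma Pi_hcomp_id_left: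
  assumes HK: "subgroup H G" "subgroup K G" and x: "x \<in> topspace (fixed_space X act H)"
    and s: "is_cell H K y \<alpha> \<gamma> \<alpha>' \<gamma>' \<sigma>"
  shows "hcomp \<C> (H, x) (H, x) (K, y) (id1 \<C> (H, x)) (id1 \<C> (H, x)) (\<alpha>, c) (\<alpha>', c')
      (id2 \<C> (H, x) (H, x) (id1 \<C> (H, x))) (orbit_class K H \<sigma>) = orbit_class K H \<sigma>"
proof -
  note s' = is_cellD[OF s]
  have \<sigma>: "path_homotopic (orbit_fixed_space G K H) (\<lambda>t. H <#> \<sigma> t) \<sigma>"
    using pathin_in_topspace[OF s'(1)] set_mult_unit_left[OF HK(1)]
    by (intro path_homotopic_sym[OF path_homotopic_eq[OF s'(1)]]) auto
  have "path_homotopic (orbit_fixed_space G K H) (join (\<lambda>_. H <#> \<alpha>) (\<lambda>t. H <#> \<sigma> t)) (\<lambda>t. H <#> \<sigma> t)"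
    using path_homotopicD(1)[OF \<sigma>] s' by (intro path_homotopic_join_const_left) auto
  also note \<sigma>
  finally show ?thesis
    unfolding Pi_id1 Pi_id2 Pi_hcomp[OF HK(1,1,2) is_cell_id[OF is_arr_id[OF HK(1) x]] s]
    by (rule path_class_eqI)
qed

lemma Pi_hcomp_id_right:
  assumes HK: "subgroup H G" "subgroup K G" and y: "y \<in> topspace (fixed_space X act K)"
    and s: "is_cell H K y \<alpha> \<gamma> \<alpha>' \<gamma>' \<sigma>"
  shows "hcomp \<C> (H, x) (K, y) (K, y) (\<alpha>, c) (\<alpha>', c') (id1 \<C> (K, y)) (id1 \<C> (K, y))
      (orbit_class K H \<sigma>) (id2 \<C> (K, y) (K, y) (id1 \<C> (K, y))) = orbit_class K H \<sigma>"
proof -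
  note s' = is_cellD[OF s]
  have \<sigma>: "path_homotopic (orbit_fixed_space G K H) (\<lambda>t. \<sigma> t <#> K) \<sigma>"
    using pathin_in_topspace[OF s'(1)] set_mult_unit_right[OF HK(2)]
    by (intro path_homotopic_sym[OF path_homotopic_eq[OF s'(1)]]) auto
  have "path_homotopic (orbit_fixed_space G K H) (join (\<lambda>t. \<sigma> t <#> K) (\<lambda>_. \<alpha>' <#> K)) (\<lambda>t. \<sigma> t <#> K)"
    using path_homotopicD(1)[OF \<sigma>] s' by (intro path_homotopic_join_const_right) auto
  also note \<sigma>
  finally show ?thesis
    unfolding Pi_id1 Pi_id2 Pi_hcomp[OF HK(1,2,2) s is_cell_id[OF is_arr_id[OF HK(2) y]]]
    by (rule path_class_eqI)
qed

text \<open>Both sides run through \<sigma>\<beta>\<eta>, \<alpha>'\<omega>\<eta> and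
  \<alpha>'\<beta>'\<upsilon>; what remains is associativity of coset products along each piece and
  of concatenation.\<close>

lemma Pi_hcomp_assoc:
  assumes HKL: "subgroup H G" "subgroup K G" "subgroup L G" and M: "subgroup M G"
    and y: "y \<in> topspace (fixed_space X act K)" and z: "z \<in> topspace (fixed_space X act L)"
    and v: "v \<in> topspace (fixed_space X act M)"
    and f: "is_arr H x K y \<alpha> \<gamma>" "is_arr H x K y \<alpha>' \<gamma>'"
    and g: "is_arr K y L z \<beta> \<zeta>" "is_arr K y L z \<beta>' \<zeta>'"
    and h: "is_arr L z M v \<eta> \<xi>" "is_arr L z M v \<eta>' \<xi>'"
    and s: "is_cell H K y \<alpha> \<gamma> \<alpha>' \<gamma>' \<sigma>" and w: "is_cell K L z \<beta> \<zeta> \<beta>' \<zeta>' \<omega>"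
    and u: "is_cell L M v \<eta> \<xi> \<eta>' \<xi>' \<upsilon>"
  shows "hcomp \<C> (H, x) (L, z) (M, v)
      (comp1 \<C> (H, x) (K, y) (L, z) (\<alpha>, fix_class H \<gamma>) (\<beta>, fix_class K \<zeta>))
      (comp1 \<C> (H, x) (K, y) (L, z) (\<alpha>', fix_class H \<gamma>') (\<beta>', fix_class K \<zeta>'))
      (\<eta>, fix_class L \<xi>) (\<eta>', fix_class L \<xi>')
      (hcomp \<C> (H, x) (K, y) (L, z) (\<alpha>, fix_class H \<gamma>) (\<alpha>', fix_class H \<gamma>')
        (\<beta>, fix_class K \<zeta>) (\<beta>', fix_class K \<zeta>') (orbit_class K H \<sigma>) (orbit_class L K \<omega>))
      (orbit_class M L \<upsilon>) =
    hcomp \<C> (H, x) (K, y) (M, v) (\<alpha>, fix_class H \<gamma>) (\<alpha>', fix_class H \<gamma>')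
      (comp1 \<C> (K, y) (L, z) (M, v) (\<beta>, fix_class K \<zeta>) (\<eta>, fix_class L \<xi>))
      (comp1 \<C> (K, y) (L, z) (M, v) (\<beta>', fix_class K \<zeta>') (\<eta>', fix_class L \<xi>'))
      (orbit_class K H \<sigma>)
      (hcomp \<C> (K, y) (L, z) (M, v) (\<beta>, fix_class K \<zeta>) (\<beta>', fix_class K \<zeta>')
        (\<eta>, fix_class L \<xi>) (\<eta>', fix_class L \<xi>') (orbit_class L K \<omega>) (orbit_class M L \<upsilon>))"
proof -
  note cells = is_cellD[OF s] is_cellD[OF w] is_cellD[OF u]
  note arrs = f[THEN is_arrD(1)] g[THEN is_arrD(1)] h[THEN is_arrD(1)]
  let ?O = "orbit_fixed_space G M H"
  note HKM = HKL(1,2) M and HLM = HKL(1,3) M and KLM = HKL(2,3) M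
  note assoc = set_mult_orbit_fixed_space_assoc[OF HKL(2,3) M, where H = H]
  have p: "pathin ?O (\<lambda>t. \<sigma> t <#> (\<beta> <#> \<eta>))" "pathin ?O (\<lambda>t. \<alpha>' <#> (\<omega> t <#> \<eta>))"
    "pathin ?O (\<lambda>t. \<alpha>' <#> (\<beta>' <#> \<upsilon> t))"
    using cells arrs set_mult_in_orbit_fixed_space[OF KLM] pathin_set_mult_left[OF HKM]
      pathin_set_mult_right[OF HKM] pathin_set_mult_left[OF KLM] pathin_set_mult_right[OF KLM] by blast+
  have "path_homotopic ?O
      (join (join (\<lambda>t. \<sigma> t <#> \<beta> <#> \<eta>) (\<lambda>t. \<alpha>' <#> \<omega> t <#> \<eta>)) (\<lambda>t. \<alpha>' <#> \<beta>' <#> \<upsilon> t))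
      (join (join (\<lambda>t. \<sigma> t <#> (\<beta> <#> \<eta>)) (\<lambda>t. \<alpha>' <#> (\<omega> t <#> \<eta>))) (\<lambda>t. \<alpha>' <#> (\<beta>' <#> \<upsilon> t)))"
    using arrs cells assoc pathin_in_topspace[OF cells(1)] pathin_in_topspace[OF cells(5)]
      pathin_in_topspace[OF cells(9)]
    by (intro path_homotopic_join path_homotopic_sym[OF path_homotopic_eq[OF p(1)]]
        path_homotopic_sym[OF path_homotopic_eq[OF p(2)]] path_homotopic_sym[OF path_homotopic_eq[OF p(3)]]) auto
  also have "path_homotopic ?O \<dots>
      (join (\<lambda>t. \<sigma> t <#> (\<beta> <#> \<eta>)) (join (\<lambda>t. \<alpha>' <#> (\<omega> t <#> \<eta>)) (\<lambda>t. \<alpha>' <#> (\<beta>' <#> \<upsilon> t))))"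
    using p cells by (intro path_homotopic_assoc) auto
  finally show ?thesis
    unfolding Pi_hcomp[OF HKL s w] Pi_hcomp[OF KLM w u]
      Pi_comp1[OF HKL(1,2) f(1) g(1)] Pi_comp1[OF HKL(1,2) f(2) g(2)]
      Pi_comp1[OF HKL(2,3) g(1) h(1)] Pi_comp1[OF HKL(2,3) g(2) h(2)]
      Pi_hcomp[OF HLM is_cell_hcomp[OF HKL y z f g s w] u]
      Pi_hcomp[OF HKM s is_cell_hcomp[OF KLM z v g h w u]]
    by (intro path_class_eqI) (simp add: image_join[of "\<lambda>\<alpha>. \<alpha> <#> \<eta>"] image_join[of "\<lambda>\<beta>. \<alpha>' <#> \<beta>"])
qed

section \<open>Closure under the operations, and the 2-category\<close>

lemma Pi_id1_arr:
  "subgroup H G \<Longrightarrow> x \<in> topspace (fixed_space X act H) \<Longrightarrow> id1 \<C> (H, x) \<in> arr \<C> (H, x) (H, x)"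
  by (simp add: Pi_id1 Pi_arrI is_arr_id)

lemma Pi_comp1_arr:
  assumes HKL: "subgroup H G" "subgroup K G" "subgroup L G" and z: "z \<in> topspace (fixed_space X act L)"
    and f: "is_arr H x K y \<alpha> \<gamma>" and g: "is_arr K y L z \<beta> \<zeta>"
  shows "comp1 \<C> (H, x) (K, y) (L, z) (\<alpha>, fix_class H \<gamma>) (\<beta>, fix_class K \<zeta>) \<in> arr \<C> (H, x) (L, z)"
  unfolding Pi_comp1[OF HKL(1,2) f g] by (rule Pi_arrI[OF is_arr_comp[OF HKL z f g]])

lemma Pi_id2_cell:
  assumes f: "is_arr H x K y \<alpha> \<gamma>"
  shows "id2 \<C> (H, x) (K, y) (\<alpha>, fix_class H \<gamma>) \<in>
    cell \<C> (H, x) (K, y) (\<alpha>, fix_class H \<gamma>) (\<alpha>, fix_class H \<gamma>)"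
  unfolding Pi_id2 by (rule Pi_cellI[OF is_cell_id[OF f] is_arrD(2)[OF f]])

lemma Pi_vcomp_cell:
  assumes HK: "subgroup H G" "subgroup K G" and y: "y \<in> topspace (fixed_space X act K)"
    and f: "is_arr H x K y \<alpha> \<gamma>"
    and s: "is_cell H K y \<alpha> \<gamma> \<alpha>' \<gamma>' \<sigma>" and t: "is_cell H K y \<alpha>' \<gamma>' \<alpha>'' \<gamma>'' \<tau>"
  shows "vcomp \<C> (H, x) (K, y) f1 f2 f3 (orbit_class K H \<sigma>) (orbit_class K H \<tau>) \<in>
    cell \<C> (H, x) (K, y) (\<alpha>, fix_class H \<gamma>) (\<alpha>'', fix_class H \<gamma>'')"
  unfolding Pi_vcomp[OF s t] by (rule Pi_cellI[OF is_cell_vcomp[OF HK y f s t] is_arrD(2)[OF f]])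

lemma Pi_hcomp_cell:
  assumes HKL: "subgroup H G" "subgroup K G" "subgroup L G"
    and y: "y \<in> topspace (fixed_space X act K)" and z: "z \<in> topspace (fixed_space X act L)"
    and f: "is_arr H x K y \<alpha> \<gamma>" "is_arr H x K y \<alpha>' \<gamma>'"
    and g: "is_arr K y L z \<beta> \<zeta>" "is_arr K y L z \<beta>' \<zeta>'"
    and s: "is_cell H K y \<alpha> \<gamma> \<alpha>' \<gamma>' \<sigma>" and w: "is_cell K L z \<beta> \<zeta> \<beta>' \<zeta>' \<omega>"
  shows "hcomp \<C> (H, x) (K, y) (L, z) (\<alpha>, fix_class H \<gamma>) (\<alpha>', fix_class H \<gamma>')
      (\<beta>, fix_class K \<zeta>) (\<beta>', fix_class K \<zeta>') (orbit_class K H \<sigma>) (orbit_class L K \<omega>) \<in>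
    cell \<C> (H, x) (L, z)
      (comp1 \<C> (H, x) (K, y) (L, z) (\<alpha>, fix_class H \<gamma>) (\<beta>, fix_class K \<zeta>))
      (comp1 \<C> (H, x) (K, y) (L, z) (\<alpha>', fix_class H \<gamma>') (\<beta>', fix_class K \<zeta>'))"
  unfolding Pi_hcomp[OF HKL s w] Pi_comp1[OF HKL(1,2) f(1) g(1)] Pi_comp1[OF HKL(1,2) f(2) g(2)]
  by (rule Pi_cellI[OF is_cell_hcomp[OF HKL y z f g s w] is_arrD(2)[OF is_arr_comp[OF HKL z f(1) g(1)]]])

theorem two_category_Pi: "two_category \<C>"
  apply unfold_locales
  apply (elim Pi_obE, hypsubst+, rule Pi_id1_arr, assumption+)
  apply (elim Pi_obE, hypsubst+, elim Pi_arrE, hypsubst+, rule Pi_comp1_arr, assumption+)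
  apply (elim Pi_obE, hypsubst+, elim Pi_arrE, hypsubst+, rule Pi_comp1_id_left, assumption+)
  apply (elim Pi_obE, hypsubst+, elim Pi_arrE, hypsubst+, rule Pi_comp1_id_right, assumption+)
  apply (elim Pi_obE, hypsubst+, elim Pi_arrE, hypsubst+, rule Pi_comp1_assoc, assumption+)
  apply (elim Pi_obE, hypsubst+, elim Pi_arrE, hypsubst+, rule Pi_id2_cell, assumption+)
  \<comment> \<open>The four further premises of \<open>Pi_cellE\<close> discharged here are the
    source arrow and the conditions on \<open>H\<close>, \<open>K\<close> and \<open>y\<close>. The
    cell is thereby represented over the paths already chosen for its boundary arrows.\<close>
  apply (elim Pi_obE, hypsubst+, elim Pi_arrE, hypsubst+,
      (erule (4) Pi_cellE)+, hypsubst+, rule Pi_vcomp_cell, assumption+)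
  apply (elim Pi_obE, hypsubst+, elim Pi_arrE, hypsubst+,
      (erule (4) Pi_cellE)+, hypsubst+, rule Pi_vcomp_id_left, assumption+)
  apply (elim Pi_obE, hypsubst+, elim Pi_arrE, hypsubst+,
      (erule (4) Pi_cellE)+, hypsubst+, rule Pi_vcomp_id_right, assumption+)
  apply (elim Pi_obE, hypsubst+, elim Pi_arrE, hypsubst+,
      (erule (4) Pi_cellE)+, hypsubst+, rule Pi_vcomp_assoc, assumption+)
  apply (elim Pi_obE, hypsubst+, elim Pi_arrE, hypsubst+,
      (erule (4) Pi_cellE)+, hypsubst+, rule Pi_hcomp_cell, assumption+)
  apply (elim Pi_obE, hypsubst+, elim Pi_arrE, hypsubst+, rule Pi_hcomp_id2, assumption+)
  apply (elim Pi_obE, hypsubst+, elim Pi_arrE, hypsubst+,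
      (erule (4) Pi_cellE)+, hypsubst+, rule Pi_interchange, assumption+)
  apply (elim Pi_obE, hypsubst+, elim Pi_arrE, hypsubst+,
      (erule (4) Pi_cellE)+, hypsubst+, rule Pi_hcomp_id_left, assumption+)
  apply (elim Pi_obE, hypsubst+, elim Pi_arrE, hypsubst+,
      (erule (4) Pi_cellE)+, hypsubst+, rule Pi_hcomp_id_right, assumption+)
  apply (elim Pi_obE, hypsubst+, elim Pi_arrE, hypsubst+,
      (erule (4) Pi_cellE)+, hypsubst+, rule Pi_hcomp_assoc, assumption+)
  done

end

section \<open>The induced 2-functor\<close>

locale equivariant_pair =
  src: smooth_action G1 X1 act1 + trg: smooth_action G2 X2 act2
  for G1 :: "('g1, 'z1) lie_group_scheme" and X1 :: "'x1 manifold" and act1 :: "'g1 \<Rightarrow> 'x1 \<Rightarrow> 'x1"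
    and G2 :: "('g2, 'z2) lie_group_scheme" and X2 :: "'x2 manifold" and act2 :: "'g2 \<Rightarrow> 'x2 \<Rightarrow> 'x2" +
  fixes \<phi> :: "'g1 \<Rightarrow> 'g2" and f :: "'x1 \<Rightarrow> 'x2"
  assumes compact_G1: "compact_space (gtop G1)"
    and equivariant: "equivariant_map G1 X1 act1 G2 X2 act2 \<phi> f"
begin

section \<open>Images of subgroups, cosets and fixed points\<close>

lemma \<phi>_hom: "\<phi> \<in> hom G1 G2"
  and continuous_\<phi>: "continuous_map (gtop G1) (gtop G2) \<phi>"
  and continuous_f: "continuous_map (mtop X1) (mtop X2) f"
  and f_act: "g \<in> carrier G1 \<Longrightarrow> x \<in> topspace (mtop X1) \<Longrightarrow> f (act1 g x) = act2 (\<phi> g) (f x)"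
  using equivariant by (auto simp: equivariant_map_def smooth_map_def)

sublocale \<phi>: group_hom G1 G2 \<phi>
  using \<phi>_hom by unfold_locales

lemmas subgroup_image = \<phi>.subgroup_img_is_subgroup

lemma closedin_image:
  assumes "closedin (gtop G1) H"
  shows "closedin (gtop G2) (\<phi> ` H)"
proof -
  have "compactin (gtop G2) (\<phi> ` H)"
    using assms compact_G1 continuous_\<phi> closedin_compact_space image_compactin by blast
  moreover have "Hausdorff_space (gtop G2)"
    using trg.mfd by (simp add: smooth_manifold_def)
  ultimately show ?thesis
    by (simp add: compactin_imp_closedin)
qed

lemma image_l_coset:
  "a \<in> carrier G1 \<Longrightarrow> subgroup K G1 \<Longrightarrow> \<phi> ` (a <#\<^bsub>G1\<^esub> K) = \<phi> a <#\<^bsub>G2\<^esub> \<phi> ` K"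
  using coset_hom(1)[OF \<phi>_hom] subgroup.subset by blast

lemma image_set_mult:
  assumes "subgroup K G1" "subgroup L G1"
    and "\<alpha> \<in> topspace (orbit_fixed_space G1 K H)" "\<beta> \<in> topspace (orbit_fixed_space G1 L K)"
  shows "\<phi> ` (\<alpha> <#>\<^bsub>G1\<^esub> \<beta>) = \<phi> ` \<alpha> <#>\<^bsub>G2\<^esub> \<phi> ` \<beta>"
  using assms by (intro set_mult_hom[OF \<phi>_hom] src.orbit_fixed_space_subset)

lemma f_fixed_space:
  assumes "subgroup H G1" "x \<in> topspace (fixed_space X1 act1 H)"
  shows "f x \<in> topspace (fixed_space X2 act2 (\<phi> ` H))"
proof -
  have x: "x \<in> topspace (mtop X1)" "\<forall>h\<in>H. act1 h x = x"
    using assms(2) by (auto simp: src.topspace_fixed_space)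
  then have "act2 (\<phi> h) (f x) = f x" if "h \<in> H" for h
    using that f_act[of h x] subgroup.mem_carrier[OF assms(1)] by simp
  then show ?thesis
    using x continuous_map_funspace[OF continuous_f] by (auto simp: trg.topspace_fixed_space)
qed

lemma continuous_map_f_fixed_space:
  assumes "subgroup H G1"
  shows "continuous_map (fixed_space X1 act1 H) (fixed_space X2 act2 (\<phi> ` H)) f"
  using f_fixed_space[OF assms] continuous_f
  unfolding fixed_space_def[of X2] continuous_map_in_subtopology
  by (auto simp: fixed_space_def src.topspace_fixed_space continuous_map_from_subtopology)

lemma image_orbit_fixed_space:
  assumes "subgroup H G1" "subgroup K G1" "\<alpha> \<in> topspace (orbit_fixed_space G1 K H)"
  shows "\<phi> ` \<alpha> \<in> topspace (orbit_fixed_space G2 (\<phi> ` K) (\<phi> ` H))"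
proof -
  obtain a where a: "a \<in> carrier G1" "\<alpha> = a <#\<^bsub>G1\<^esub> K"
    using assms(3) by (rule src.orbit_fixed_spaceE)
  then have "\<phi> ` \<alpha> \<in> lcosets\<^bsub>G2\<^esub> (\<phi> ` K)"
    using image_l_coset[OF _ assms(2)] by (auto simp: LCOSETS_def)
  moreover have "\<phi> h <#\<^bsub>G2\<^esub> \<phi> ` \<alpha> = \<phi> ` \<alpha>" if "h \<in> H" for h
    using coset_hom(1)[OF \<phi>_hom src.orbit_fixed_space_subset[OF assms(3,2)], of h] assms(3) that
      subgroup.mem_carrier[OF assms(1) that]
    by (simp add: src.topspace_orbit_fixed_space)
  ultimately show ?thesis
    by (auto simp: trg.topspace_orbit_fixed_space)
qed

text \<open>On lifts the map is \<phi> followed by the coset map of \<phi>(K). It descends because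
  the coset map from the lift space onto (G1/K)^H is continuous, open and surjective, hence a
  quotient map.\<close>

lemma continuous_map_image_orbit_fixed_space:
  assumes H: "subgroup H G1" and K: "subgroup K G1"
  shows "continuous_map (orbit_fixed_space G1 K H) (orbit_fixed_space G2 (\<phi> ` K) (\<phi> ` H)) ((`) \<phi>)"
proof -
  let ?q = "\<lambda>a. a <#\<^bsub>G1\<^esub> K" and ?A = "src.lift_space K H"
  have "continuous_map ?A (orbit_space G1 K) ?q"
    unfolding src.lift_space_def by (intro continuous_map_from_subtopology src.continuous_map_orbit_space)
  then have "continuous_map ?A (orbit_fixed_space G1 K H) ?q"
    unfolding orbit_fixed_space_def continuous_map_in_subtopology
    by (auto simp: src.topspace_lift_space src.topspace_orbit_fixed_space)
  then have q: "quotient_map ?A (orbit_fixed_space G1 K H) ?q"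
    using src.open_map_orbit_fixed_space[OF K]
    by (intro continuous_open_imp_quotient_map) (auto simp: src.topspace_orbit_fixed_space_lift)
  have "continuous_map ?A (orbit_space G2 (\<phi> ` K)) (\<lambda>a. \<phi> a <#\<^bsub>G2\<^esub> \<phi> ` K)"
    using continuous_map_compose[OF continuous_\<phi> trg.continuous_map_orbit_space[of "\<phi> ` K"]]
    unfolding src.lift_space_def o_def by (intro continuous_map_from_subtopology)
  then have "continuous_map ?A (orbit_space G2 (\<phi> ` K)) ((`) \<phi> \<circ> ?q)"
    by (rule continuous_map_eq) (auto simp: src.topspace_lift_space image_l_coset[OF _ K])
  then have "continuous_map (orbit_fixed_space G1 K H) (orbit_space G2 (\<phi> ` K)) ((`) \<phi>)"
    using q continuous_compose_quotient_map by blast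
  then show ?thesis
    using image_orbit_fixed_space[OF H K]
    unfolding orbit_fixed_space_def[of G2] continuous_map_in_subtopology
    by (auto simp: trg.topspace_orbit_fixed_space)
qed

text \<open>Equivariance at a representative: if a represents \<alpha>, then \<phi>(a) represents
  the image coset, and f(ay) = \<phi>(a)f(y).\<close>

lemma f_coset_act:
  assumes K: "subgroup K G1" and \<alpha>: "\<alpha> \<in> topspace (orbit_fixed_space G1 K H)"
    and y: "y \<in> topspace (fixed_space X1 act1 K)"
  shows "f (coset_act act1 \<alpha> y) = coset_act act2 (\<phi> ` \<alpha>) (f y)"
proof -
  obtain a where a: "a \<in> carrier G1" "\<alpha> = a <#\<^bsub>G1\<^esub> K"
    using \<alpha> by (rule src.orbit_fixed_spaceE)
  have "f (coset_act act1 \<alpha> y) = act2 (\<phi> a) (f y)"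
    using a y f_act[of a y] by (simp add: src.coset_act_l_coset[OF K] src.topspace_fixed_space)
  also have "\<dots> = coset_act act2 (\<phi> ` \<alpha>) (f y)"
    using a trg.coset_act_l_coset[OF subgroup_image[OF K] _ f_fixed_space[OF K y]]
    by (simp add: image_l_coset[OF _ K])
  finally show ?thesis .
qed

section \<open>Images of representatives\<close>

lemma is_arr_image:
  assumes H: "subgroup H G1" and K: "subgroup K G1" and y: "y \<in> topspace (fixed_space X1 act1 K)"
    and u: "src.is_arr H x K y \<alpha> \<gamma>"
  shows "trg.is_arr (\<phi> ` H) (f x) (\<phi> ` K) (f y) (\<phi> ` \<alpha>) (\<lambda>t. f (\<gamma> t))"
  using src.is_arrD[OF u] image_orbit_fixed_space[OF H K] f_coset_act[OF K _ y]
    pathin_image[OF _ continuous_map_f_fixed_space[OF H]]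
  by (auto simp: trg.is_arr_def)

lemma is_cell_image:
  assumes H: "subgroup H G1" and K: "subgroup K G1" and y: "y \<in> topspace (fixed_space X1 act1 K)"
    and u: "src.is_arr H x K y \<alpha> \<gamma>" and s: "src.is_cell H K y \<alpha> \<gamma> \<alpha>' \<gamma>' \<sigma>"
  shows "trg.is_cell (\<phi> ` H) (\<phi> ` K) (f y) (\<phi> ` \<alpha>) (\<lambda>t. f (\<gamma> t)) (\<phi> ` \<alpha>') (\<lambda>t. f (\<gamma>' t)) (\<lambda>t. \<phi> ` \<sigma> t)"
proof -
  note u' = src.is_arrD[OF u] and s' = src.is_cellD[OF s]
  let ?F = "fixed_space X2 act2 (\<phi> ` H)"
  have \<sigma>: "pathin (orbit_fixed_space G2 (\<phi> ` K) (\<phi> ` H)) (\<lambda>t. \<phi> ` \<sigma> t)"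
    using pathin_image[OF s'(1) continuous_map_image_orbit_fixed_space[OF H K]] .
  have p: "pathin ?F (\<lambda>t. coset_act act2 (\<phi> ` \<sigma> t) (f y))"
    by (rule trg.pathin_coset_act_left[OF subgroup_image[OF H] subgroup_image[OF K] f_fixed_space[OF K y] \<sigma>])
  \<comment> \<open>\<open>f_coset_act\<close> identifies \<phi>(\<sigma>(t))f(y) with
    f(\<sigma>(t)y) for t in the unit interval. The path then becomes the image under
    \<open>f\<close> of \<gamma> * \<sigma>y, and the homotopy of the cell can be pushed
    forward.\<close>
  have "path_homotopic ?F (join (\<lambda>t. f (\<gamma> t)) (\<lambda>t. coset_act act2 (\<phi> ` \<sigma> t) (f y)))
      (join (\<lambda>t. f (\<gamma> t)) (\<lambda>t. f (coset_act act1 (\<sigma> t) y)))"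
    using u' s' pathin_in_topspace[OF s'(1)] f_coset_act[OF K _ y, where H = H]
      pathin_image[OF u'(2) continuous_map_f_fixed_space[OF H]]
    by (intro path_homotopic_join path_homotopic_refl path_homotopic_eq[OF p]) auto
  also have "path_homotopic ?F \<dots> (\<lambda>t. f (\<gamma>' t))"
    using path_homotopic_image[OF s'(4) continuous_map_f_fixed_space[OF H]] by (simp add: image_join)
  finally show ?thesis
    using \<sigma> s' by (simp add: trg.is_cell_def)
qed

section \<open>The induced map on objects, arrows and 2-cells\<close>

abbreviation "\<F> \<equiv> Pi_map G2 X2 act2 \<phi> f"

lemma map0_Pi: "map0 \<F> (H, x) = (\<phi> ` H, f x)"
  by (simp add: Pi_map_def)

lemma map1_Pi:
  assumes "subgroup H G1" "src.is_arr H x K y \<alpha> \<gamma>"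
  shows "map1 \<F> (H, x) (K, y) (\<alpha>, src.fix_class H \<gamma>) = (\<phi> ` \<alpha>, trg.fix_class (\<phi> ` H) (\<lambda>t. f (\<gamma> t)))"
  using UN_path_class[OF src.is_arrD(2)[OF assms(2)], of "fixed_space X2 act2 (\<phi> ` H)" "(\<circ>) f"]
    path_homotopic_image[OF _ continuous_map_f_fixed_space[OF assms(1)]]
  by (simp add: Pi_map_def o_def)

lemma map2_Pi:
  assumes "subgroup H G1" "subgroup K G1" "src.is_cell H K y \<alpha> \<gamma> \<alpha>' \<gamma>' \<sigma>"
  shows "map2 \<F> (H, x) (K, y) u u' (src.orbit_class K H \<sigma>) = trg.orbit_class (\<phi> ` K) (\<phi> ` H) (\<lambda>t. \<phi> ` \<sigma> t)"
  using UN_path_class[OF src.is_cellD(1)[OF assms(3)], of "orbit_fixed_space G2 (\<phi> ` K) (\<phi> ` H)" "\<lambda>\<sigma> t. \<phi> ` \<sigma> t"]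
    path_homotopic_image[OF _ continuous_map_image_orbit_fixed_space[OF assms(1,2)]]
  by (simp add: Pi_map_def)

lemma map0_Pi_ob:
  assumes "subgroup H G1" "closedin (gtop G1) H" "x \<in> topspace (fixed_space X1 act1 H)"
  shows "map0 \<F> (H, x) \<in> ob trg.\<C>"
  using subgroup_image[OF assms(1)] closedin_image[OF assms(2)] f_fixed_space[OF assms(1,3)]
  by (simp add: map0_Pi Pi_two_cat_def)

lemma map1_Pi_arr:
  assumes HK: "subgroup H G1" "subgroup K G1" and y: "y \<in> topspace (fixed_space X1 act1 K)"
    and u: "src.is_arr H x K y \<alpha> \<gamma>"
  shows "map1 \<F> (H, x) (K, y) (\<alpha>, src.fix_class H \<gamma>) \<in> arr trg.\<C> (map0 \<F> (H, x)) (map0 \<F> (K, y))"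
  unfolding map0_Pi map1_Pi[OF HK(1) u] by (rule trg.Pi_arrI[OF is_arr_image[OF HK y u]])

lemma map2_Pi_cell:
  assumes HK: "subgroup H G1" "subgroup K G1" and y: "y \<in> topspace (fixed_space X1 act1 K)"
    and u: "src.is_arr H x K y \<alpha> \<gamma>" "src.is_arr H x K y \<alpha>' \<gamma>'"
    and s: "src.is_cell H K y \<alpha> \<gamma> \<alpha>' \<gamma>' \<sigma>"
  shows "map2 \<F> (H, x) (K, y) u1 u2 (src.orbit_class K H \<sigma>) \<in>
    cell trg.\<C> (map0 \<F> (H, x)) (map0 \<F> (K, y))
      (map1 \<F> (H, x) (K, y) (\<alpha>, src.fix_class H \<gamma>)) (map1 \<F> (H, x) (K, y) (\<alpha>', src.fix_class H \<gamma>'))"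
  unfolding map0_Pi map1_Pi[OF HK(1) u(1)] map1_Pi[OF HK(1) u(2)] map2_Pi[OF HK s]
  by (rule trg.Pi_cellI[OF is_cell_image[OF HK y u(1) s] trg.is_arrD(2)[OF is_arr_image[OF HK y u(1)]]])

section \<open>Preservation of identities and compositions\<close>

lemma map1_id1_Pi:
  assumes H: "subgroup H G1" and x: "x \<in> topspace (fixed_space X1 act1 H)"
  shows "map1 \<F> (H, x) (H, x) (id1 src.\<C> (H, x)) = id1 trg.\<C> (map0 \<F> (H, x))"
  unfolding src.Pi_id1 map0_Pi map1_Pi[OF H src.is_arr_id[OF H x]] trg.Pi_id1 ..

text \<open>The coset components agree by \<open>image_set_mult\<close>. The path components are
  f(\<gamma>) * f(\<alpha>\<zeta>) and f(\<gamma>) * \<phi>(\<alpha>)f(\<zeta>), whose second pieces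
  agree on the unit interval by \<open>f_coset_act\<close>.\<close>

lemma map1_comp1_Pi:
  assumes HKL: "subgroup H G1" "subgroup K G1" "subgroup L G1"
    and y: "y \<in> topspace (fixed_space X1 act1 K)" and z: "z \<in> topspace (fixed_space X1 act1 L)"
    and u: "src.is_arr H x K y \<alpha> \<gamma>" and v: "src.is_arr K y L z \<beta> \<zeta>"
  shows "map1 \<F> (H, x) (L, z)
      (comp1 src.\<C> (H, x) (K, y) (L, z) (\<alpha>, src.fix_class H \<gamma>) (\<beta>, src.fix_class K \<zeta>)) =
    comp1 trg.\<C> (map0 \<F> (H, x)) (map0 \<F> (K, y)) (map0 \<F> (L, z))
      (map1 \<F> (H, x) (K, y) (\<alpha>, src.fix_class H \<gamma>)) (map1 \<F> (K, y) (L, z) (\<beta>, src.fix_class K \<zeta>))"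
proof -
  note u' = src.is_arrD[OF u] and v' = src.is_arrD[OF v]
  note images = HKL[THEN subgroup_image]
  let ?F = "fixed_space X2 act2 (\<phi> ` H)"
  have p: "pathin ?F (\<lambda>t. f (coset_act act1 \<alpha> (\<zeta> t)))"
    using pathin_image[OF src.pathin_coset_act_right[OF HKL(1,2) u'(1) v'(2)] continuous_map_f_fixed_space[OF HKL(1)]] .
  have "path_homotopic ?F (join (\<lambda>t. f (\<gamma> t)) (\<lambda>t. f (coset_act act1 \<alpha> (\<zeta> t))))
      (join (\<lambda>t. f (\<gamma> t)) (\<lambda>t. coset_act act2 (\<phi> ` \<alpha>) (f (\<zeta> t))))"
    using u' v' pathin_in_topspace[OF v'(2)] f_coset_act[OF HKL(2) u'(1)]
      pathin_image[OF u'(2) continuous_map_f_fixed_space[OF HKL(1)]]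
    by (intro path_homotopic_join path_homotopic_refl path_homotopic_eq[OF p]) auto
  then show ?thesis
    unfolding map0_Pi src.Pi_comp1[OF HKL(1,2) u v] map1_Pi[OF HKL(1) src.is_arr_comp[OF HKL z u v]]
      map1_Pi[OF HKL(1) u] map1_Pi[OF HKL(2) v]
      trg.Pi_comp1[OF images(1,2) is_arr_image[OF HKL(1,2) y u] is_arr_image[OF HKL(2,3) z v]]
    by (simp add: image_join[of f] image_set_mult[OF HKL(2,3) u'(1) v'(1)] path_class_eqI)
qed

lemma map2_id2_Pi:
  assumes "subgroup H G1" "subgroup K G1" "src.is_arr H x K y \<alpha> \<gamma>"
  shows "map2 \<F> (H, x) (K, y) u u' (id2 src.\<C> (H, x) (K, y) (\<alpha>, src.fix_class H \<gamma>)) =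
    id2 trg.\<C> (map0 \<F> (H, x)) (map0 \<F> (K, y)) (map1 \<F> (H, x) (K, y) (\<alpha>, src.fix_class H \<gamma>))"
  unfolding src.Pi_id2 map2_Pi[OF assms(1,2) src.is_cell_id[OF assms(3)]] map0_Pi map1_Pi[OF assms(1,3)] trg.Pi_id2 ..

text \<open>Applying \<phi> pointwise commutes with concatenation exactly, so both sides are the
  class of the same function.\<close>

lemma map2_vcomp_Pi:
  assumes HK: "subgroup H G1" "subgroup K G1" and y: "y \<in> topspace (fixed_space X1 act1 K)"
    and s: "src.is_cell H K y \<alpha> \<gamma> \<alpha>' \<gamma>' \<sigma>" and t: "src.is_cell H K y \<alpha>' \<gamma>' \<alpha>'' \<gamma>'' \<tau>"
    and u: "src.is_arr H x K y \<alpha> \<gamma>" "src.is_arr H x K y \<alpha>' \<gamma>'"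
  shows "map2 \<F> (H, x) (K, y) u1 u3
      (vcomp src.\<C> (H, x) (K, y) u1 u2 u3 (src.orbit_class K H \<sigma>) (src.orbit_class K H \<tau>)) =
    vcomp trg.\<C> (map0 \<F> (H, x)) (map0 \<F> (K, y)) v1 v2 v3
      (map2 \<F> (H, x) (K, y) u1 u2 (src.orbit_class K H \<sigma>))
      (map2 \<F> (H, x) (K, y) u2 u3 (src.orbit_class K H \<tau>))"
  unfolding src.Pi_vcomp[OF s t] map2_Pi[OF HK src.is_cell_vcomp[OF HK y u(1) s t]]
    map2_Pi[OF HK s] map2_Pi[OF HK t] map0_Pi
    trg.Pi_vcomp[OF is_cell_image[OF HK y u(1) s] is_cell_image[OF HK y u(2) t]] image_join ..

text \<open>Multiplicativity of \<phi> on cosets turns \<phi>(\<sigma>(t)\<beta>) into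
  \<phi>(\<sigma>(t))\<phi>(\<beta>) and \<phi>(\<alpha>'\<omega>(t)) into
  \<phi>(\<alpha>')\<phi>(\<omega>(t)) at times in the unit interval; the two concatenations are
  therefore homotopic piece by piece.\<close>

lemma map2_hcomp_Pi:
  assumes HKL: "subgroup H G1" "subgroup K G1" "subgroup L G1"
    and y: "y \<in> topspace (fixed_space X1 act1 K)" and z: "z \<in> topspace (fixed_space X1 act1 L)"
    and u: "src.is_arr H x K y \<alpha> \<gamma>" "src.is_arr H x K y \<alpha>' \<gamma>'"
    and v: "src.is_arr K y L z \<beta> \<zeta>" "src.is_arr K y L z \<beta>' \<zeta>'"
    and s: "src.is_cell H K y \<alpha> \<gamma> \<alpha>' \<gamma>' \<sigma>" and w: "src.is_cell K L z \<beta> \<zeta> \<beta>' \<zeta>' \<omega>"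
  shows "map2 \<F> (H, x) (L, z) u1 u2
      (hcomp src.\<C> (H, x) (K, y) (L, z) (\<alpha>, src.fix_class H \<gamma>) (\<alpha>', src.fix_class H \<gamma>')
        (\<beta>, src.fix_class K \<zeta>) (\<beta>', src.fix_class K \<zeta>') (src.orbit_class K H \<sigma>) (src.orbit_class L K \<omega>)) =
    hcomp trg.\<C> (map0 \<F> (H, x)) (map0 \<F> (K, y)) (map0 \<F> (L, z))
      (map1 \<F> (H, x) (K, y) (\<alpha>, src.fix_class H \<gamma>)) (map1 \<F> (H, x) (K, y) (\<alpha>', src.fix_class H \<gamma>'))
      (map1 \<F> (K, y) (L, z) (\<beta>, src.fix_class K \<zeta>)) (map1 \<F> (K, y) (L, z) (\<beta>', src.fix_class K \<zeta>'))
      (map2 \<F> (H, x) (K, y) u3 u4 (src.orbit_class K H \<sigma>))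
      (map2 \<F> (K, y) (L, z) u5 u6 (src.orbit_class L K \<omega>))"
proof -
  note s' = src.is_cellD[OF s] and w' = src.is_cellD[OF w]
  note arrs = u[THEN src.is_arrD(1)] v[THEN src.is_arrD(1)]
  note images = HKL[THEN subgroup_image]
  let ?O = "orbit_fixed_space G2 (\<phi> ` L) (\<phi> ` H)"
  have p: "pathin ?O (\<lambda>t. \<phi> ` (\<sigma> t <#>\<^bsub>G1\<^esub> \<beta>))" "pathin ?O (\<lambda>t. \<phi> ` (\<alpha>' <#>\<^bsub>G1\<^esub> \<omega> t))"
    using pathin_image[OF src.pathin_set_mult_left[OF HKL arrs(3) s'(1)] continuous_map_image_orbit_fixed_space[OF HKL(1,3)]]
      pathin_image[OF src.pathin_set_mult_right[OF HKL arrs(2) w'(1)] continuous_map_image_orbit_fixed_space[OF HKL(1,3)]] .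
  have "path_homotopic ?O (join (\<lambda>t. \<phi> ` (\<sigma> t <#>\<^bsub>G1\<^esub> \<beta>)) (\<lambda>t. \<phi> ` (\<alpha>' <#>\<^bsub>G1\<^esub> \<omega> t)))
      (join (\<lambda>t. \<phi> ` \<sigma> t <#>\<^bsub>G2\<^esub> \<phi> ` \<beta>) (\<lambda>t. \<phi> ` \<alpha>' <#>\<^bsub>G2\<^esub> \<phi> ` \<omega> t))"
    using s' w' arrs pathin_in_topspace[OF s'(1)] pathin_in_topspace[OF w'(1)]
      image_set_mult[OF HKL(2,3), where H = H]
    by (intro path_homotopic_join path_homotopic_eq[OF p(1)] path_homotopic_eq[OF p(2)]) auto
  then show ?thesis
    unfolding src.Pi_hcomp[OF HKL s w] map2_Pi[OF HKL(1,3) src.is_cell_hcomp[OF HKL y z u v s w]]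
      map0_Pi map1_Pi[OF HKL(1) u(1)] map1_Pi[OF HKL(1) u(2)] map1_Pi[OF HKL(2) v(1)] map1_Pi[OF HKL(2) v(2)]
      map2_Pi[OF HKL(1,2) s] map2_Pi[OF HKL(2,3) w]
      trg.Pi_hcomp[OF images is_cell_image[OF HKL(1,2) y u(1) s] is_cell_image[OF HKL(2,3) z v(1) w]]
    by (simp add: image_join path_class_eqI)
qed

theorem two_functor_Pi: "two_functor src.\<C> trg.\<C> \<F>"
  apply (rule two_functor.intro[OF src.two_category_Pi trg.two_category_Pi two_functor_axioms.intro])
  apply (elim src.Pi_obE, hypsubst+, rule map0_Pi_ob, assumption+)
  apply (elim src.Pi_obE, hypsubst+, elim src.Pi_arrE, hypsubst+, rule map1_Pi_arr, assumption+)
  apply (elim src.Pi_obE, hypsubst+, elim src.Pi_arrE, hypsubst+,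
      (erule (4) src.Pi_cellE)+, hypsubst+, rule map2_Pi_cell, assumption+)
  apply (elim src.Pi_obE, hypsubst+, rule map1_id1_Pi, assumption+)
  apply (elim src.Pi_obE, hypsubst+, elim src.Pi_arrE, hypsubst+, rule map1_comp1_Pi, assumption+)
  apply (elim src.Pi_obE, hypsubst+, elim src.Pi_arrE, hypsubst+, rule map2_id2_Pi, assumption+)
  apply (elim src.Pi_obE, hypsubst+, elim src.Pi_arrE, hypsubst+,
      (erule (4) src.Pi_cellE)+, hypsubst+, rule map2_vcomp_Pi, assumption+)
  apply (elim src.Pi_obE, hypsubst+, elim src.Pi_arrE, hypsubst+,
      (erule (4) src.Pi_cellE)+, hypsubst+, rule map2_hcomp_Pi, assumption+)
  done

end

theorem proposition4p5:
  fixes G1 :: "('g1, 'z1) lie_group_scheme" and X1 :: "'x1 manifold"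
    and act1 :: "'g1 \<Rightarrow> 'x1 \<Rightarrow> 'x1"
    and G2 :: "('g2, 'z2) lie_group_scheme" and X2 :: "'x2 manifold"
    and act2 :: "'g2 \<Rightarrow> 'x2 \<Rightarrow> 'x2"
    and \<phi> :: "'g1 \<Rightarrow> 'g2" and f :: "'x1 \<Rightarrow> 'x2"
  assumes "compact_lie_group G1" and "compact_lie_group G2"
    and "smooth_action G1 X1 act1" and "smooth_action G2 X2 act2"
    and "equivariant_map G1 X1 act1 G2 X2 act2 \<phi> f"
  shows "two_functor (Pi_two_cat G1 X1 act1) (Pi_two_cat G2 X2 act2) (Pi_map G2 X2 act2 \<phi> f)"
proof -
  interpret equivariant_pair G1 X1 act1 G2 X2 act2 \<phi> f
    using assms by (intro equivariant_pair.intro equivariant_pair_axioms.intro compact_lie_group.compact)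
  show ?thesis by (rule two_functor_Pi)
qed

end
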